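(* For any integers $N,l$, finite simple graphs $H_1,\dots,H_l$, real numbers $\beta_1,\dots,\beta_l$ and $\varepsilon\in(0,1/2)$, there exists a coupling $(G,G')$ such that $G$ has the law of the exponential random graph $$\mathbb{P}(G=g)=Z^{-1}\exp\Big(N^2\sum_{i=1}^l\beta_i t(H_i,g)\Big)\quad\text{for all simple graphs } g \text{ on } N \text{ vertices},$$ ($Z$ a normalizing constant), $G'$ is an $\varepsilon$-mixture, and $$\mathbb{E}\,d_H(G,G')\le\frac{20\binom N2^{11/12}}{\varepsilon^{1/3}}\left(\sum_{i=1}^l|\beta_i||E(H_i)|\right)^{1/3},$$ where $|E(H_i)|$ is the number of edges of $H_i$.
   Context: For finite graphs $H,G$ with $m,N$ vertices, $\mathrm{Hom}(H,G)$ is the number of maps from $V(H)$ to $V(G)$ sending every edge of $H$ to an edge of $G$, and $t(H,G)=\mathrm{Hom}(H,G)/N^m$. For $\vec p\in[0,1]^{\binom N2}$, $G(N,\vec p)$ is the random graph on $[N]$ with independent edges, edge $\{i,j\}$ present with probability $p_{i,j}$; $I(\vec p)=-\sum_{\{i,j\}}\big(p_{i,j}\log p_{i,j}+(1-p_{i,j})\log(1-p_{i,j})\big)=\mathrm{Ent}(G(N,\vec p))$. For a probability measure $\rho$ on $[0,1]^{\binom N2}$, $G(N,\rho)$ is the mixture with $\mathbb{P}(G(N,\rho)=g)=\int\mathbb{P}(G(N,\vec p)=g)\,d\rho(\vec p)$. A random graph $G$ on $N$ vertices is an $\varepsilon$-mixture if there is $\rho$ with $G\overset{d}{=}G(N,\rho)$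 and $\mathrm{Ent}(G)\le\int I(\vec p)\,d\rho(\vec p)+\varepsilon\binom N2$, where $\mathrm{Ent}$ is Shannon entropy. For graphs $g=(V,E),g'=(V,E')$, $d_H(g,g')=|E\triangle E'|$. *)

theory Defs
  imports "HOL-Probability.Probability"
begin

text \<open>Simple graphs on the vertex set {0..<n} are represented by their edge sets:
  sets of 2-element subsets of {0..<n}.\<close>

definition all_edges :: "nat \<Rightarrow> nat set set" where
  "all_edges n = {e. e \<subseteq> {..<n} \<and> card e = 2}"

definition graphs :: "nat \<Rightarrow> nat set set set" where
  "graphs n = Pow (all_edges n)"

text \<open>A finite simple graph H is a pair (m, EH): m vertices {0..<m}, edge set EH.\<close>

definition is_simple_graph :: "nat \<times> nat set set \<Rightarrow> bool" where
  "is_simple_graph H \<longleftrightarrow> snd H \<subseteq> all_edges (fst H)"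

definition hom_count :: "nat \<times> nat set set \<Rightarrow> nat \<Rightarrow> nat set set \<Rightarrow> nat" where
  "hom_count H N g =
     card {f \<in> {..<fst H} \<rightarrow>\<^sub>E {..<N}. \<forall>e\<in>snd H. f ` e \<in> g}"

definition hom_density :: "nat \<times> nat set set \<Rightarrow> nat \<Rightarrow> nat set set \<Rightarrow> real" where
  "hom_density H N g = real (hom_count H N g) / real N ^ fst H"

definition ergm_weight :: "nat \<Rightarrow> nat \<Rightarrow> (nat \<Rightarrow> nat \<times> nat set set) \<Rightarrow> (nat \<Rightarrow> real)
    \<Rightarrow> nat set set \<Rightarrow> real" where
  "ergm_weight N l H \<beta> g = exp (real N ^ 2 * (\<Sum>i<l. \<beta> i * hom_density (H i) N g))"

definition is_ergm_law :: "nat \<Rightarrow> nat \<Rightarrow> (nat \<Rightarrow> nat \<times> nat set set) \<Rightarrow> (nat \<Rightarrow> real)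
    \<Rightarrow> nat set set pmf \<Rightarrow> bool" where
  "is_ergm_law N l H \<beta> G \<longleftrightarrow>
     (\<forall>g. pmf G g = (if g \<in> graphs N
        then ergm_weight N l H \<beta> g / (\<Sum>g'\<in>graphs N. ergm_weight N l H \<beta> g') else 0))"

definition indep_graph_prob :: "nat \<Rightarrow> (nat set \<Rightarrow> real) \<Rightarrow> nat set set \<Rightarrow> real" where
  "indep_graph_prob N p g = (\<Prod>e\<in>all_edges N. if e \<in> g then p e else 1 - p e)"

definition xlnx :: "real \<Rightarrow> real" where
  "xlnx x = (if x = 0 then 0 else x * ln x)"

text \<open>I(p) = Ent(G(N,p)).\<close>
definition I_ent :: "nat \<Rightarrow> (nat set \<Rightarrow> real) \<Rightarrow> real" where
  "I_ent N p = - (\<Sum>e\<in>all_edges N. xlnx (p e) + xlnx (1 - p e))"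

definition graph_entropy :: "nat \<Rightarrow> nat set set pmf \<Rightarrow> real" where
  "graph_entropy N G = - (\<Sum>g\<in>graphs N. xlnx (pmf G g))"

definition is_mixture_of :: "nat \<Rightarrow> (nat set \<Rightarrow> real) measure \<Rightarrow> nat set set pmf \<Rightarrow> bool" where
  "is_mixture_of N \<rho> G \<longleftrightarrow>
     prob_space \<rho> \<and>
     sets \<rho> = sets (PiM (all_edges N) (\<lambda>_. borel :: real measure)) \<and>
     (AE p in \<rho>. \<forall>e\<in>all_edges N. 0 \<le> p e \<and> p e \<le> 1) \<and>
     set_pmf G \<subseteq> graphs N \<and>
     (\<forall>g\<in>graphs N. pmf G g = (\<integral>p. indep_graph_prob N p g \<partial>\<rho>))"

definition is_eps_mixture :: "nat \<Rightarrow> real \<Rightarrow> nat set set pmf \<Rightarrow> bool" where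
  "is_eps_mixture N \<epsilon> G \<longleftrightarrow>
     (\<exists>\<rho>. is_mixture_of N \<rho> G \<and>
        graph_entropy N G \<le> (\<integral>p. I_ent N p \<partial>\<rho>) + \<epsilon> * real (N choose 2))"

definition ham_dist :: "nat set set \<Rightarrow> nat set set \<Rightarrow> nat" where
  "ham_dist g g' = card ((g - g') \<union> (g' - g))"

end

theory Submission
  imports Defs
begin

text \<open>Write \<open>n\<close> for the number of possible edges and \<open>B\<close> for \<open>\<Sum>\<bar>\<beta>\<^sub>i\<bar> |E(H\<^sub>i)|\<close>. Label each graph \<open>X\<close> by
  iterating the following step: record the pair of vertex sets (and a sign) on which \<open>X\<close> deviates most
  from its conditional mean given the labels so far. Each step costs entropy \<open>O(N)\<close> and, if the
  expected cut distance between \<open>X\<close> and its conditional mean \<open>p\<close> is \<open>\<delta>\<close>, increases the energy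
  \<open>E \<parallel>p\<parallel>\<^sup>2 \<le> n\<close> by order \<open>\<delta>\<^sup>2/n\<close>. So an entropy budget \<open>\<eta> n\<close> achieves \<open>\<delta> = O(n\<^bsup>3/4\<^esup> \<eta>\<^bsup>-1/2\<^esup>)\<close>.

  Let \<open>G'\<close> be the mixture over labels of the product measures with these conditional means. The Gibbs
  variational principle for each product measure bounds the averaged relative entropy between the
  conditioned law of \<open>X\<close> and the product measure by \<open>\<eta> n\<close> plus the difference of the expected
  Hamiltonians, which by the counting lemma is \<open>B O(\<delta> + n\<^bsup>3/4\<^esup>)\<close>. Marton's inequality turns this into
  \<open>E d\<^sub>H \<le> (n (\<eta> n + B O(n\<^bsup>3/4\<^esup> \<eta>\<^bsup>-1/2\<^esup>)))\<^bsup>1/2\<^esup>\<close>, and one optimises over \<open>\<eta> \<le> \<epsilon>\<close>.\<close>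

section \<open>Energy increment for conditional means\<close>

text \<open>Giving the product measure of a label the conditional edge probabilities makes its
  marginals agree with those of the conditioned law. As the log density of a product measure is
  affine in the edge indicators, their relative entropy is an exact difference of entropies minus
  nothing else, so the variational principle loses only the label entropy and the change of the
  Hamiltonian; the partition function cancels on average. One entropy budget thus serves twice: in
  this bound and in the condition defining an \<open>\<epsilon>\<close>-mixture. The two error terms
  balance when \<open>\<eta>\<close> is the power 2/3 of \<open>B / n^(1/4)\<close>. Then
  \<open>n * sqrt \<eta>\<close> is the product of \<open>n^(11/12)\<close> and
  \<open>B^(1/3)\<close>, which is the source of the exponents. If this \<open>\<eta>\<close>
  exceeds \<open>\<epsilon>\<close>, the budget is capped at \<open>\<epsilon>\<close>; the factor
  \<open>\<epsilon>^(-1/3)\<close> absorbs the loss wherever the claim is stronger than the trivial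
  bound \<open>n\<close>.\<close>

definition cond_mean :: "('x \<Rightarrow> real) \<Rightarrow> 'x set \<Rightarrow> ('x \<Rightarrow> 'y) \<Rightarrow> ('x \<Rightarrow> real) \<Rightarrow> 'y \<Rightarrow> real" where
  "cond_mean w \<Omega> Y g y = (\<Sum>X\<in>{X\<in>\<Omega>. Y X = y}. w X * g X) / (\<Sum>X\<in>{X\<in>\<Omega>. Y X = y}. w X)"

text \<open>For a label of weight zero the quotient is a division by zero, hence 0, so the bounds
  hold for every \<open>y\<close>.\<close>

lemma cond_mean_bounds:
  assumes "finite \<Omega>" "\<And>X. X \<in> \<Omega> \<Longrightarrow> 0 \<le> w X" "\<And>X. X \<in> \<Omega> \<Longrightarrow> 0 \<le> g X \<and> g X \<le> 1"
  shows "0 \<le> cond_mean w \<Omega> Y g y" "cond_mean w \<Omega> Y g y \<le> 1"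
proof -
  show "0 \<le> cond_mean w \<Omega> Y g y"
    unfolding cond_mean_def using assms by (intro divide_nonneg_nonneg sum_nonneg) auto
  have "(\<Sum>X\<in>{X\<in>\<Omega>. Y X = y}. w X * g X) \<le> (\<Sum>X\<in>{X\<in>\<Omega>. Y X = y}. w X)"
    using assms by (intro sum_mono) (simp add: mult_left_le)
  moreover have "0 \<le> (\<Sum>X\<in>{X\<in>\<Omega>. Y X = y}. w X)"
    using assms by (intro sum_nonneg) auto
  ultimately show "cond_mean w \<Omega> Y g y \<le> 1"
    unfolding cond_mean_def divide_le_eq_1 by linarith
qed

lemma sum_fibres:
  assumes "finite \<Omega>"
  shows "(\<Sum>X\<in>\<Omega>. h X) = (\<Sum>y\<in>Y ` \<Omega>. \<Sum>X\<in>{X\<in>\<Omega>. Y X = y}. h X)"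
  using sum.image_gen[OF assms] by blast

text \<open>The projection property of conditional expectation. \<open>h (Y X)\<close> is constant
  on a fibre; a fibre of weight zero adds 0 to both sides because all its weights vanish.\<close>

lemma cond_mean_tower:
  assumes "finite \<Omega>" "\<And>X. X \<in> \<Omega> \<Longrightarrow> 0 \<le> w X"
  shows "(\<Sum>X\<in>\<Omega>. w X * (cond_mean w \<Omega> Y g (Y X) * h (Y X))) = (\<Sum>X\<in>\<Omega>. w X * (g X * h (Y X)))"
proof -
  have "(\<Sum>X\<in>{X\<in>\<Omega>. Y X = y}. w X * (cond_mean w \<Omega> Y g (Y X) * h (Y X)))
      = (\<Sum>X\<in>{X\<in>\<Omega>. Y X = y}. w X * (g X * h (Y X)))" for y
  proof (cases "(\<Sum>X\<in>{X\<in>\<Omega>. Y X = y}. w X) = 0")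
    case True
    then have "\<forall>X\<in>{X\<in>\<Omega>. Y X = y}. w X = 0"
      using assms by (subst (asm) sum_nonneg_eq_0_iff) auto
    then show ?thesis by (intro sum.cong) auto
  next
    case False
    have "(\<Sum>X\<in>{X\<in>\<Omega>. Y X = y}. w X * (cond_mean w \<Omega> Y g (Y X) * h (Y X)))
       = (\<Sum>X\<in>{X\<in>\<Omega>. Y X = y}. w X) * (cond_mean w \<Omega> Y g y * h y)"
      by (simp add: sum_distrib_right)
    also have "\<dots> = (\<Sum>X\<in>{X\<in>\<Omega>. Y X = y}. w X * g X) * h y"
      using False by (simp add: cond_mean_def)
    also have "\<dots> = (\<Sum>X\<in>{X\<in>\<Omega>. Y X = y}. w X * (g X * h (Y X)))"
      by (simp add: sum_distrib_right mult.assoc)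
    finally show ?thesis .
  qed
  then show ?thesis
    by (subst (1 2) sum_fibres[OF assms(1), of _ Y]) simp
qed

text \<open>Stands in for Cauchy-Schwarz: with \<open>\<kappa>\<close> free the bound is linear in
  the square of \<open>d\<close>, so it can be summed and averaged before \<open>\<kappa>\<close> is
  chosen.\<close>

lemma abs_le_amgm:
  fixes d \<kappa> :: real
  assumes "0 < \<kappa>"
  shows "2 * \<bar>d\<bar> \<le> \<kappa> + d\<^sup>2 / \<kappa>"
proof -
  have "2 * \<bar>d\<bar> * \<kappa> \<le> \<kappa> * \<kappa> + d\<^sup>2"
    using zero_le_power2[of "\<kappa> - \<bar>d\<bar>"] by (simp add: power2_diff power2_eq_square[of \<kappa>] mult_ac)
  then have "(2 * \<bar>d\<bar> * \<kappa>) / \<kappa> \<le> (\<kappa> * \<kappa> + d\<^sup>2) / \<kappa>"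
    using assms by (intro divide_right_mono) auto
  then show ?thesis using assms by (simp add: add_divide_distrib)
qed

text \<open>For cut vectors this is a cut norm of the deviation of \<open>X\<close> from its
  conditional mean. The absolute value is encoded by putting signs into \<open>J\<close>.\<close>

definition max_corr :: "('x \<Rightarrow> real) \<Rightarrow> 'x set \<Rightarrow> 'u set \<Rightarrow> ('x \<Rightarrow> 'u \<Rightarrow> real) \<Rightarrow> 'j set \<Rightarrow> ('j \<Rightarrow> 'u \<Rightarrow> real)
    \<Rightarrow> ('x \<Rightarrow> 'y) \<Rightarrow> 'x \<Rightarrow> real" where
  "max_corr w \<Omega> U x J v Y X =
     (MAX j\<in>J. \<Sum>u\<in>U. (x X u - cond_mean w \<Omega> Y (\<lambda>X. x X u) (Y X)) * v j u)"

text \<open>The potential function of weak regularity arguments.\<close>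

definition energy :: "('x \<Rightarrow> real) \<Rightarrow> 'x set \<Rightarrow> 'u set \<Rightarrow> ('x \<Rightarrow> 'u \<Rightarrow> real) \<Rightarrow> ('x \<Rightarrow> 'y) \<Rightarrow> real" where
  "energy w \<Omega> U x Y = (\<Sum>X\<in>\<Omega>. w X * (\<Sum>u\<in>U. (cond_mean w \<Omega> Y (\<lambda>X. x X u) (Y X))\<^sup>2))"

lemma max_corr_attained:
  assumes "finite J" "J \<noteq> {}"
  shows "\<exists>j\<in>J. max_corr w \<Omega> U x J v Y X
     = (\<Sum>u\<in>U. (x X u - cond_mean w \<Omega> Y (\<lambda>X. x X u) (Y X)) * v j u)"
proof -
  have "max_corr w \<Omega> U x J v Y X \<in> (\<lambda>j. \<Sum>u\<in>U. (x X u - cond_mean w \<Omega> Y (\<lambda>X. x X u) (Y X)) * v j u) ` J"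
    unfolding max_corr_def using assms by (intro Max_in) auto
  then show ?thesis by auto
qed

text \<open>Appending the extremal direction to the label makes \<^term>\<open>max_corr\<close> visible to the new
  conditional mean, so a large value forces an energy gain (Pythagoras plus AM-GM).\<close>
lemma energy_increment:
  fixes W :: "'x \<Rightarrow> 'j" and Y :: "'x \<Rightarrow> 'j list"
  assumes fin: "finite \<Omega>" and w: "\<And>X. X \<in> \<Omega> \<Longrightarrow> 0 \<le> w X" and w1: "(\<Sum>X\<in>\<Omega>. w X) = 1"
    and W: "\<And>X. X \<in> \<Omega> \<Longrightarrow> W X \<in> J \<and> max_corr w \<Omega> U x J v Y X
     = (\<Sum>u\<in>U. (x X u - cond_mean w \<Omega> Y (\<lambda>X. x X u) (Y X)) * v (W X) u)"
    and v: "\<And>j u. j \<in> J \<Longrightarrow> u \<in> U \<Longrightarrow> \<bar>v j u\<bar> \<le> 2" and k: "0 < \<kappa>"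
  shows "(\<Sum>X\<in>\<Omega>. w X * max_corr w \<Omega> U x J v Y X)
    \<le> \<kappa> * real (card U) + (energy w \<Omega> U x (\<lambda>X. W X # Y X) - energy w \<Omega> U x Y) / \<kappa>"
proof -
  define Y' where "Y' = (\<lambda>X. W X # Y X)"
  define p where "p u X = cond_mean w \<Omega> Y (\<lambda>X. x X u) (Y X)" for u X
  define p' where "p' u X = cond_mean w \<Omega> Y' (\<lambda>X. x X u) (Y' X)" for u X
  have tower': "(\<Sum>X\<in>\<Omega>. w X * (p' u X * h (Y' X))) = (\<Sum>X\<in>\<Omega>. w X * (x X u * h (Y' X)))" for u h
    unfolding p'_def by (rule cond_mean_tower) (use fin w in auto)
  have tower: "(\<Sum>X\<in>\<Omega>. w X * (p u X * h (Y X))) = (\<Sum>X\<in>\<Omega>. w X * (x X u * h (Y X)))" for u h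
    unfolding p_def by (rule cond_mean_tower) (use fin w in auto)
  \<comment> \<open>The old label is the tail of the new one, so the old conditional mean is a
    function of the new label and \<open>tower'\<close> applies to it.\<close>
  have p_tl: "p u X = cond_mean w \<Omega> Y (\<lambda>X. x X u) (tl (Y' X))" for u X
    by (simp add: p_def Y'_def)
  have pp': "(\<Sum>X\<in>\<Omega>. w X * (p' u X * p u X)) = (\<Sum>X\<in>\<Omega>. w X * (p u X)\<^sup>2)" for u
    using tower'[of u "\<lambda>l. cond_mean w \<Omega> Y (\<lambda>X. x X u) (tl l)"]
      tower[of u "\<lambda>l. cond_mean w \<Omega> Y (\<lambda>X. x X u) l"]
    by (simp add: p_tl[symmetric] p_def[symmetric] power2_eq_square)
  have sq: "(\<Sum>X\<in>\<Omega>. w X * (p' u X - p u X)\<^sup>2)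
       = (\<Sum>X\<in>\<Omega>. w X * (p' u X)\<^sup>2) - (\<Sum>X\<in>\<Omega>. w X * (p u X)\<^sup>2)" for u
  proof -
    have "(\<Sum>X\<in>\<Omega>. w X * (p' u X - p u X)\<^sup>2) = (\<Sum>X\<in>\<Omega>. w X * (p' u X)\<^sup>2)
        - 2 * (\<Sum>X\<in>\<Omega>. w X * (p' u X * p u X)) + (\<Sum>X\<in>\<Omega>. w X * (p u X)\<^sup>2)"
      by (simp add: power2_eq_square sum_distrib_left sum_subtractf sum.distrib[symmetric] algebra_simps)
    then show ?thesis using pp' by simp
  qed
  have en: "(\<Sum>u\<in>U. \<Sum>X\<in>\<Omega>. w X * (p' u X - p u X)\<^sup>2) = energy w \<Omega> U x Y' - energy w \<Omega> U x Y"
    unfolding sq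
    unfolding energy_def sum_subtractf p_def p'_def sum_distrib_left
    by (intro arg_cong2[where f="(-)"] sum.swap)
  have "(\<Sum>X\<in>\<Omega>. w X * max_corr w \<Omega> U x J v Y X)
      = (\<Sum>u\<in>U. \<Sum>X\<in>\<Omega>. w X * ((x X u - p u X) * v (W X) u))"
  proof -
    have "(\<Sum>X\<in>\<Omega>. w X * max_corr w \<Omega> U x J v Y X)
        = (\<Sum>X\<in>\<Omega>. \<Sum>u\<in>U. w X * ((x X u - p u X) * v (W X) u))"
      unfolding p_def sum_distrib_left[symmetric] using W by (intro sum.cong) simp_all
    then show ?thesis by (subst sum.swap)
  qed
  \<comment> \<open>The direction \<open>W X\<close> is the head of the new label. The test vector
    is therefore a function of that label, and \<open>x\<close> may be replaced by
    \<open>p'\<close>.\<close>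
  also have "\<dots> = (\<Sum>u\<in>U. \<Sum>X\<in>\<Omega>. w X * ((p' u X - p u X) * v (W X) u))"
  proof (rule sum.cong[OF refl])
    fix u
    have "(\<Sum>X\<in>\<Omega>. w X * (p' u X * v (W X) u)) = (\<Sum>X\<in>\<Omega>. w X * (x X u * v (W X) u))"
      using tower'[of u "\<lambda>l. v (hd l) u"] by (simp add: Y'_def)
    then show "(\<Sum>X\<in>\<Omega>. w X * ((x X u - p u X) * v (W X) u)) = (\<Sum>X\<in>\<Omega>. w X * ((p' u X - p u X) * v (W X) u))"
      by (simp add: algebra_simps sum_subtractf)
  qed
  also have "\<dots> \<le> (\<Sum>u\<in>U. \<Sum>X\<in>\<Omega>. w X * (\<kappa> + (p' u X - p u X)\<^sup>2 / \<kappa>))"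
  proof (intro sum_mono mult_left_mono)
    fix u X assume uX: "u \<in> U" "X \<in> \<Omega>"
    let ?d = "p' u X - p u X"
    have "?d * v (W X) u \<le> \<bar>?d\<bar> * \<bar>v (W X) u\<bar>"
      unfolding abs_mult[symmetric] by (rule abs_ge_self)
    also have "\<dots> \<le> \<bar>?d\<bar> * 2"
      using v[of "W X" u] W[of X] uX by (intro mult_left_mono) auto
    also have "\<dots> \<le> \<kappa> + ?d\<^sup>2 / \<kappa>"
      using abs_le_amgm[OF k, of ?d] by simp

    finally show "?d * v (W X) u \<le> \<kappa> + ?d\<^sup>2 / \<kappa>" .
  qed (use w in auto)
  also have "\<dots> = (\<Sum>u\<in>U. \<kappa> * (\<Sum>X\<in>\<Omega>. w X) + (\<Sum>X\<in>\<Omega>. w X * (p' u X - p u X)\<^sup>2) / \<kappa>)"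
    by (simp add: algebra_simps sum.distrib sum_distrib_left sum_divide_distrib)
  also have "\<dots> = \<kappa> * real (card U) + (\<Sum>u\<in>U. \<Sum>X\<in>\<Omega>. w X * (p' u X - p u X)\<^sup>2) / \<kappa>"
    by (simp add: w1 sum.distrib sum_divide_distrib)
  finally show ?thesis unfolding en Y'_def .
qed

lemma energy_bounds:
  assumes fin: "finite \<Omega>" and w: "\<And>X. X \<in> \<Omega> \<Longrightarrow> 0 \<le> w X" and w1: "(\<Sum>X\<in>\<Omega>. w X) = 1"
    and x: "\<And>X u. X \<in> \<Omega> \<Longrightarrow> u \<in> U \<Longrightarrow> 0 \<le> x X u \<and> x X u \<le> 1"
  shows "0 \<le> energy w \<Omega> U x Y" "energy w \<Omega> U x Y \<le> real (card U)"
proof -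
  show "0 \<le> energy w \<Omega> U x Y"
    unfolding energy_def using w by (intro sum_nonneg mult_nonneg_nonneg) auto
  have "(\<Sum>u\<in>U. (cond_mean w \<Omega> Y (\<lambda>X. x X u) y)\<^sup>2) \<le> (\<Sum>u\<in>U. 1)" for y
  proof (rule sum_mono)
    fix u assume "u \<in> U"
    then show "(cond_mean w \<Omega> Y (\<lambda>X. x X u) y)\<^sup>2 \<le> 1"
      using cond_mean_bounds[of \<Omega> w "\<lambda>X. x X u" Y y] fin w x by (simp add: power_le_one)
  qed
  then have "energy w \<Omega> U x Y \<le> (\<Sum>X\<in>\<Omega>. w X * real (card U))"
    unfolding energy_def using w by (intro sum_mono mult_left_mono) auto
  then show "energy w \<Omega> U x Y \<le> real (card U)"
    by (simp add: sum_distrib_right[symmetric] w1)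
qed

text \<open>The energy stays in \<open>[0, card U]\<close>, so one of \<open>T + 1\<close>
  successive refinements gains at most \<open>card U / (T + 1)\<close>. The label just before that
  refinement already has small expected correlation.\<close>

lemma low_correlation_labelling:
  fixes x :: "'x \<Rightarrow> 'u \<Rightarrow> real" and v :: "'j \<Rightarrow> 'u \<Rightarrow> real"
  assumes fin: "finite \<Omega>" and w: "\<And>X. X \<in> \<Omega> \<Longrightarrow> 0 \<le> w X" and w1: "(\<Sum>X\<in>\<Omega>. w X) = 1"
    and x: "\<And>X u. X \<in> \<Omega> \<Longrightarrow> u \<in> U \<Longrightarrow> 0 \<le> x X u \<and> x X u \<le> 1"
    and J: "finite J" "J \<noteq> {}" and v: "\<And>j u. j \<in> J \<Longrightarrow> u \<in> U \<Longrightarrow> \<bar>v j u\<bar> \<le> 2"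
  shows "\<exists>Y :: 'x \<Rightarrow> 'j list. card (Y ` \<Omega>) \<le> card J ^ T \<and>
    (\<Sum>X\<in>\<Omega>. w X * max_corr w \<Omega> U x J v Y X) \<le> 2 * real (card U) / sqrt (real (Suc T))"
proof -
  define W where "W Y X = (SOME j. j \<in> J \<and> max_corr w \<Omega> U x J v Y X
     = (\<Sum>u\<in>U. (x X u - cond_mean w \<Omega> Y (\<lambda>X. x X u) (Y X)) * v j u))" for Y :: "'x \<Rightarrow> 'j list" and X
  have W: "W Y X \<in> J \<and> max_corr w \<Omega> U x J v Y X
     = (\<Sum>u\<in>U. (x X u - cond_mean w \<Omega> Y (\<lambda>X. x X u) (Y X)) * v (W Y X) u)" for Y X
  proof -
    have "\<exists>j. j \<in> J \<and> max_corr w \<Omega> U x J v Y X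
     = (\<Sum>u\<in>U. (x X u - cond_mean w \<Omega> Y (\<lambda>X. x X u) (Y X)) * v j u)"
      using max_corr_attained[OF J, of w \<Omega> U x v Y X] by blast
    from someI_ex[OF this] show ?thesis by (simp only: W_def)
  qed
  define Ys where "Ys t = ((\<lambda>Y X. W Y X # Y X) ^^ t) (\<lambda>_. [])" for t
  have Ys_Suc: "Ys (Suc t) = (\<lambda>X. W (Ys t) X # Ys t X)" for t by (simp add: Ys_def)
  have Ys_lists: "Ys t X \<in> {l. set l \<subseteq> J \<and> length l = t}" for t X
  proof (induction t)
    case 0 then show ?case by (simp add: Ys_def)
  next
    case (Suc t) then show ?case using W[of "Ys t" X] by (auto simp: Ys_Suc)
  qed
  have card_Ys: "card (Ys t ` \<Omega>) \<le> card J ^ t" for t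
  proof -
    have "card (Ys t ` \<Omega>) \<le> card {l. set l \<subseteq> J \<and> length l = t}"
      using Ys_lists J by (intro card_mono finite_lists_length_eq) auto
    then show ?thesis using J by (simp add: card_lists_length_eq)
  qed
  let ?e = "\<lambda>t. energy w \<Omega> U x (Ys t)"
  have "\<exists>t\<le>T. ?e (Suc t) - ?e t \<le> real (card U) / real (Suc T)"
  proof (rule ccontr)
    assume neg: "\<not> ?thesis"
    have "real (card U) = (\<Sum>t<Suc T. real (card U) / real (Suc T))" by simp
    also have "\<dots> < (\<Sum>t<Suc T. ?e (Suc t) - ?e t)"
    proof (rule sum_strict_mono)
      fix t assume "t \<in> {..<Suc T}"
      then have "t \<le> T" by simp
      with neg show "real (card U) / real (Suc T) < ?e (Suc t) - ?e t"
        by (auto simp only: not_le)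
    qed auto
    also have "\<dots> = ?e (Suc T) - ?e 0" by (rule sum_lessThan_telescope)
    also have "\<dots> \<le> real (card U)"
    proof -
      have "0 \<le> ?e 0"
        by (rule energy_bounds(1)) (use fin w w1 x in auto)
      moreover have "?e (Suc T) \<le> real (card U)"
        by (rule energy_bounds(2)) (use fin w w1 x in auto)
      ultimately show ?thesis by simp
    qed
    finally show False by simp
  qed
  then obtain t where t: "t \<le> T" "?e (Suc t) - ?e t \<le> real (card U) / real (Suc T)" by blast
  define s where "s = sqrt (real (Suc T))"
  have s: "s > 0" "s * s = real (Suc T)" by (simp_all add: s_def)
  \<comment> \<open>The choice \<open>\<kappa> = 1 / s\<close> makes both terms equal to
    \<open>card U / s\<close>.\<close>
  have "(\<Sum>X\<in>\<Omega>. w X * max_corr w \<Omega> U x J v (Ys t) X)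
     \<le> (1/s) * real (card U) + (?e (Suc t) - ?e t) / (1/s)"
    unfolding Ys_Suc by (rule energy_increment) (use fin w w1 W v s in auto)
  also have "\<dots> \<le> (1/s) * real (card U) + (real (card U) / real (Suc T)) / (1/s)"
    using t s by (intro add_left_mono divide_right_mono) auto
  also have "\<dots> = 2 * real (card U) / s"
    unfolding s(2)[symmetric] using s(1) by simp
  finally have "(\<Sum>X\<in>\<Omega>. w X * max_corr w \<Omega> U x J v (Ys t) X) \<le> 2 * real (card U) / s" .
  moreover have "card (Ys t ` \<Omega>) \<le> card J ^ T"
  proof -
    have "1 \<le> card J" using J by (simp add: Suc_le_eq card_gt_0_iff)
    then have "card J ^ t \<le> card J ^ T" using t by (intro power_increasing)
    then show ?thesis using card_Ys[of t] by linarith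
  qed
  ultimately show ?thesis unfolding s_def by blast
qed

section \<open>Couplings with product measures\<close>

definition indep_set :: "'a set \<Rightarrow> ('a \<Rightarrow> real) \<Rightarrow> 'a set pmf" where
  "indep_set E p = map_pmf Collect (Pi_pmf E False (\<lambda>u. bernoulli_pmf (p u)))"

lemma pmf_indep_set:
  assumes "finite E" "\<And>u. u \<in> E \<Longrightarrow> 0 \<le> p u \<and> p u \<le> 1"
  shows "pmf (indep_set E p) X = (if X \<subseteq> E then \<Prod>u\<in>E. if u \<in> X then p u else 1 - p u else 0)"
proof -
  have inj: "inj Collect" by (auto simp: inj_def)
  have "pmf (indep_set E p) X = pmf (Pi_pmf E False (\<lambda>u. bernoulli_pmf (p u))) (\<lambda>u. u \<in> X)"
    using pmf_map_inj'[OF inj, of "Pi_pmf E False (\<lambda>u. bernoulli_pmf (p u))" "\<lambda>u. u \<in> X"]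
    by (simp add: indep_set_def)
  also have "\<dots> = (if X \<subseteq> E then \<Prod>u\<in>E. pmf (bernoulli_pmf (p u)) (u \<in> X) else 0)"
    using assms(1) by (subst pmf_Pi) auto
  also have "(\<Prod>u\<in>E. pmf (bernoulli_pmf (p u)) (u \<in> X)) = (\<Prod>u\<in>E. if u \<in> X then p u else 1 - p u)"
    using assms(2) by (intro prod.cong) auto
  finally show ?thesis .
qed

lemma set_indep_set:
  assumes "finite E"
  shows "set_pmf (indep_set E p) \<subseteq> Pow E"
  using set_Pi_pmf_subset[OF assms, of False "\<lambda>u. bernoulli_pmf (p u)"] by (auto simp: indep_set_def)

lemma indep_set_insert:
  assumes "finite E" "e \<notin> E"
  shows "indep_set (insert e E) p =
    bernoulli_pmf (p e) \<bind> (\<lambda>y. map_pmf (\<lambda>Y. if y then insert e Y else Y) (indep_set E p))"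
proof -
  let ?P = "Pi_pmf E False (\<lambda>u. bernoulli_pmf (p u))"
  have *: "map_pmf (\<lambda>f. Collect (f(e := y))) ?P = map_pmf (\<lambda>f. if y then insert e (Collect f) else Collect f) ?P" for y
  proof (rule map_pmf_cong[OF refl])
    fix f assume "f \<in> set_pmf ?P"
    then have "\<not> f e" using set_Pi_pmf_subset[OF assms(1), of False "\<lambda>u. bernoulli_pmf (p u)"] assms(2) by auto
    then show "Collect (f(e := y)) = (if y then insert e (Collect f) else Collect f)"
      by (auto simp: fun_upd_apply split: if_splits)
  qed
  show ?thesis
    unfolding indep_set_def using assms
    by (simp add: Pi_pmf_insert' map_bind_pmf map_pmf_comp * [symmetric] flip: map_pmf_def)
qed

lemma prob_in_indep_set:
  assumes "finite E" "u \<in> E" "0 \<le> p u" "p u \<le> 1"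
  shows "measure_pmf.prob (indep_set E p) {X. u \<in> X} = p u"
proof -
  have "map_pmf (\<lambda>X. u \<in> X) (indep_set E p) = bernoulli_pmf (p u)"
    using assms Pi_pmf_component[OF assms(1), of u False "\<lambda>u. bernoulli_pmf (p u)"]
    by (simp add: indep_set_def map_pmf_comp)
  then have "pmf (map_pmf (\<lambda>X. u \<in> X) (indep_set E p)) True = p u"
    using assms by simp
  then show ?thesis by (simp add: pmf_map vimage_def)
qed

text \<open>Relative entropy of two Bernoulli laws. Because \<open>ln 0 = 0\<close>, the formula is
  the true divergence only under absolute continuity, hence the assumptions on \<open>p = 0\<close>
  and \<open>p = 1\<close> in the lemmas about it.\<close>

definition bernoulli_kl :: "real \<Rightarrow> real \<Rightarrow> real" where
  "bernoulli_kl a p = a * (ln a - ln p) + (1 - a) * (ln (1 - a) - ln (1 - p))"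

text \<open>From \<open>ln t \<le> t - 1\<close> at \<open>t = sqrt (p / a)\<close>.\<close>

lemma entropy_term_ge:
  fixes a p :: real
  assumes "0 \<le> a" "0 \<le> p" "p = 0 \<Longrightarrow> a = 0"
  shows "2 * (a - sqrt a * sqrt p) \<le> a * (ln a - ln p)"
proof (cases "a = 0")
  case False
  with assms have pos: "0 < a" "0 < p" by (auto simp: le_less)
  have "ln (sqrt (p / a)) \<le> sqrt (p / a) - 1"
    using pos by (intro ln_le_minus_one) auto
  then have "ln p - ln a \<le> 2 * (sqrt p / sqrt a - 1)"
    using pos by (simp add: ln_sqrt ln_div real_sqrt_divide)
  then have "a * (ln p - ln a) \<le> a * (2 * (sqrt p / sqrt a - 1))"
    using pos by (intro mult_left_mono) auto
  also have "\<dots> = 2 * (sqrt a * sqrt p - a)"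
  proof -
    have "a * (sqrt p / sqrt a) = (a / sqrt a) * sqrt p" by simp
    then have "a * (sqrt p / sqrt a) = sqrt a * sqrt p" using pos by (simp only: real_div_sqrt less_imp_le)
    then show ?thesis by (simp only: right_diff_distrib mult.left_commute[of a 2])
  qed
  finally show ?thesis by (simp add: algebra_simps)
qed simp

text \<open>Relative entropy dominates the squared Hellinger distance, which suffices in place of Pinsker.\<close>
lemma bernoulli_kl_ge:
  assumes "0 \<le> a" "a \<le> 1" "0 \<le> p" "p \<le> 1" "p = 0 \<Longrightarrow> a = 0" "p = 1 \<Longrightarrow> a = 1"
  shows "(a - p)\<^sup>2 \<le> bernoulli_kl a p"
proof -
  define r s r' s' where "r = sqrt a" and "s = sqrt p" and "r' = sqrt (1 - a)" and "s' = sqrt (1 - p)"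
  have sq: "r * r = a" "s * s = p" "r' * r' = 1 - a" "s' * s' = 1 - p"
    using assms by (simp_all add: r_def s_def r'_def s'_def)
  \<comment> \<open>Read \<open>r\<close>, \<open>r'\<close> as sine and cosine of \<open>x\<close>,
    and \<open>s\<close>, \<open>s'\<close> as those of \<open>y\<close>. Then
    \<open>c = cos (x - y)\<close> and \<open>a - p = sin (x - y) * sin (x + y)\<close>, so the
    square of \<open>a - p\<close> is at most \<open>1 - c^2 \<le> 2 * (1 - c)\<close>.\<close>
  define c where "c = r * s + r' * s'"
  have "(r - s)\<^sup>2 + (r' - s')\<^sup>2 = 2 * (1 - c)"
    by (simp add: power2_diff power2_eq_square sq c_def algebra_simps)
  then have c1: "c \<le> 1" by (smt (verit) zero_le_power2)
  have "(r * s' - r' * s)\<^sup>2 + c\<^sup>2 = (r * r + r' * r') * (s * s + s' * s')"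
    by (simp add: c_def power2_eq_square algebra_simps)
  then have A: "(r * s' - r' * s)\<^sup>2 = 1 - c\<^sup>2" by (simp add: sq)
  have "(r * s' - r' * s) * (r * s' + r' * s) = (r * r) * (s' * s') - (r' * r') * (s * s)"
    by (simp add: algebra_simps)
  then have B: "(r * s' - r' * s) * (r * s' + r' * s) = a - p" unfolding sq by (simp add: algebra_simps)
  have "(r * s' + r' * s)\<^sup>2 + (r * s - r' * s')\<^sup>2 = (r * r + r' * r') * (s * s + s' * s')"
    by (simp add: power2_eq_square algebra_simps)
  moreover have "(r * r + r' * r') * (s * s + s' * s') = 1" unfolding sq by simp
  ultimately have C: "(r * s' + r' * s)\<^sup>2 \<le> 1" using zero_le_power2[of "r * s - r' * s'"] by linarith
  have "(a - p)\<^sup>2 = (1 - c\<^sup>2) * (r * s' + r' * s)\<^sup>2"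
    by (simp only: B[symmetric] power_mult_distrib A)
  also have "\<dots> \<le> (1 - c\<^sup>2) * 1"
    by (intro mult_left_mono C) (simp add: A[symmetric])
  also have "\<dots> = 1 - c\<^sup>2" by simp
  also have "\<dots> \<le> 2 * (1 - c)"
    using zero_le_power2[of "1 - c"] by (simp add: power2_diff)
  also have "\<dots> = 2 * (a - r * s) + 2 * ((1 - a) - r' * s')" by (simp add: c_def)
  also have "\<dots> \<le> bernoulli_kl a p"
    unfolding bernoulli_kl_def r_def s_def r'_def s'_def
    using assms by (intro add_mono entropy_term_ge) auto
  finally show ?thesis .
qed

text \<open>The maximal coupling: the diagonal carries \<open>min a p\<close> and
  \<open>1 - max a p\<close>, which leaves only mass \<open>\<bar>a - p\<bar>\<close> for
  disagreement.\<close>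

lemma bernoulli_coupling:
  assumes "0 \<le> a" "a \<le> 1" "0 \<le> p" "p \<le> 1"
  obtains R :: "(bool \<times> bool) pmf" where "map_pmf fst R = bernoulli_pmf a" "map_pmf snd R = bernoulli_pmf p"
    "measure_pmf.expectation R (\<lambda>(x, y). of_bool (x \<noteq> y)) = \<bar>a - p\<bar>"
proof -
  define f :: "bool \<times> bool \<Rightarrow> real" where
    "f = (\<lambda>(x, y). if x then (if y then min a p else max (a - p) 0)
                 else (if y then max (p - a) 0 else 1 - max a p))"
  have UNIV_eq: "(UNIV :: (bool \<times> bool) set) = {(True, True), (True, False), (False, True), (False, False)}"
    by (auto simp: UNIV_bool)
  have nn: "0 \<le> f z" for z using assms by (auto simp: f_def split: prod.splits)
  have one: "(\<Sum>z\<in>UNIV. f z) = 1"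
    unfolding UNIV_eq by (simp add: f_def)
  have prob: "(\<integral>\<^sup>+z. ennreal (f z) \<partial>count_space UNIV) = 1"
    using one nn by (simp add: nn_integral_count_space_finite)
  define R where "R = embed_pmf f"
  have R: "pmf R z = f z" for z
    unfolding R_def by (rule pmf_embed_pmf) (use nn prob in auto)
  have sum: "measure_pmf.prob R A = (\<Sum>z\<in>A. f z)" for A
    by (subst measure_measure_pmf_finite) (auto simp: R)
  have eqI: "P = Q" if "pmf P True = pmf Q True" for P Q :: "bool pmf"
    by (rule pmf_eqI) (metis (full_types) pmf_False_conv_True that)
  have vims: "fst -` {True} = {(True, True), (True, False)}" "snd -` {True} = {(True, True), (False, True)}"
    by (auto simp: vimage_def)
  have "map_pmf fst R = bernoulli_pmf a"
    by (rule eqI) (simp add: pmf_map sum vims f_def assms)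
  moreover have "map_pmf snd R = bernoulli_pmf p"
    by (rule eqI) (simp add: pmf_map sum vims f_def assms)
  moreover have "measure_pmf.expectation R (\<lambda>(x, y). of_bool (x \<noteq> y)) = \<bar>a - p\<bar>"
  proof -
    have "measure_pmf.expectation R (\<lambda>(x, y). of_bool (x \<noteq> y)) = (\<Sum>z\<in>UNIV. f z * (case z of (x, y) \<Rightarrow> of_bool (x \<noteq> y)))"
      by (subst integral_measure_pmf[of UNIV]) (simp_all add: R)
    then show ?thesis unfolding UNIV_eq by (simp add: f_def)
  qed
  ultimately show ?thesis by (rule that)
qed

text \<open>Relative entropy of \<open>M\<close> with respect to \<open>indep_set E p\<close>, again
  genuine only under absolute continuity. Keeping the log density as a sum over elements makes its
  mean a function of the marginals.\<close>

definition kl_indep :: "'a set pmf \<Rightarrow> 'a set \<Rightarrow> ('a \<Rightarrow> real) \<Rightarrow> real" where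
  "kl_indep M E p =
     (\<Sum>X\<in>Pow E. pmf M X * (ln (pmf M X) - (\<Sum>u\<in>E. ln (if u \<in> X then p u else 1 - p u))))"

lemma sum_Pow_insert:
  assumes "finite E" "e \<notin> E"
  shows "(\<Sum>X\<in>Pow (insert e E). h X) = (\<Sum>X\<in>Pow E. h (insert e X)) + (\<Sum>X\<in>Pow E. h X)"
proof -
  have "inj_on (insert e) (Pow E)" using assms(2) by (auto simp: inj_on_def)
  then show ?thesis
    unfolding Pow_insert using assms
    by (subst sum.union_disjoint) (auto simp: sum.reindex add.commute)
qed

text \<open>Chain rule for relative entropy; \<open>MT\<close> and \<open>MF\<close> are the laws of
  the rest given that \<open>e\<close> is present or absent. Wherever a logarithm fails to split
  because a factor is zero, the weight in front of it is zero as well.\<close>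

lemma kl_indep_insert:
  assumes "finite E" "e \<notin> E" "0 \<le> a" "a \<le> 1"
    and T: "\<And>X. X \<subseteq> E \<Longrightarrow> pmf M (insert e X) = a * pmf MT X"
    and F: "\<And>X. X \<subseteq> E \<Longrightarrow> pmf M X = (1 - a) * pmf MF X"
    and supp: "set_pmf MT \<subseteq> Pow E" "set_pmf MF \<subseteq> Pow E"
  shows "kl_indep M (insert e E) p = bernoulli_kl a (p e) + a * kl_indep MT E p + (1 - a) * kl_indep MF E p"
proof -
  let ?S = "\<lambda>X. \<Sum>u\<in>E. ln (if u \<in> X then p u else 1 - p u)"
  have eq: "c * m * (ln (c * m) - (ln q + s)) = m * (c * (ln c - ln q)) + c * (m * (ln m - s))"
    if "0 \<le> c" "0 \<le> m" for c m q s :: real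
    using that by (cases "c = 0"; cases "m = 0") (auto simp: ln_mult algebra_simps)
  have S_ins: "(\<Sum>u\<in>insert e E. ln (if u \<in> insert e X then p u else 1 - p u)) = ln (p e) + ?S X" for X
    using assms(1,2) by (simp, intro sum.cong) (auto)
  have S_id: "(\<Sum>u\<in>insert e E. ln (if u \<in> X then p u else 1 - p u)) = ln (1 - p e) + ?S X" if "X \<subseteq> E" for X
    using assms(1,2) that by auto
  have "(\<Sum>X\<in>Pow E. pmf M (insert e X) * (ln (pmf M (insert e X)) - (\<Sum>u\<in>insert e E. ln (if u \<in> insert e X then p u else 1 - p u))))
     = (\<Sum>X\<in>Pow E. pmf MT X * (a * (ln a - ln (p e))) + a * (pmf MT X * (ln (pmf MT X) - ?S X)))"
    unfolding S_ins using assms(3) by (intro sum.cong refl) (simp add: T eq pmf_nonneg)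
  also have "\<dots> = a * (ln a - ln (p e)) + a * kl_indep MT E p"
    using sum_pmf_eq_1[OF _ supp(1)] assms(1)
    by (simp add: sum.distrib kl_indep_def sum_distrib_left flip: sum_distrib_right)
  finally have 1: "(\<Sum>X\<in>Pow E. pmf M (insert e X) * (ln (pmf M (insert e X)) - (\<Sum>u\<in>insert e E. ln (if u \<in> insert e X then p u else 1 - p u))))
     = a * (ln a - ln (p e)) + a * kl_indep MT E p" .
  have "(\<Sum>X\<in>Pow E. pmf M X * (ln (pmf M X) - (\<Sum>u\<in>insert e E. ln (if u \<in> X then p u else 1 - p u))))
     = (\<Sum>X\<in>Pow E. pmf MF X * ((1 - a) * (ln (1 - a) - ln (1 - p e))) + (1 - a) * (pmf MF X * (ln (pmf MF X) - ?S X)))"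
    using assms(4) by (intro sum.cong refl) (simp only: Pow_iff S_id F eq pmf_nonneg diff_ge_0_iff_ge)
  also have "\<dots> = (1 - a) * (ln (1 - a) - ln (1 - p e)) + (1 - a) * kl_indep MF E p"
    using sum_pmf_eq_1[OF _ supp(2)] assms(1)
    by (simp add: sum.distrib kl_indep_def sum_distrib_left flip: sum_distrib_right)
  finally show ?thesis
    using 1 unfolding kl_indep_def[of M "insert e E"] sum_Pow_insert[OF assms(1,2)] bernoulli_kl_def by simp
qed

lemma reveal_element:
  fixes M :: "'a set pmf"
  obtains MT MF where
    "M = bernoulli_pmf (measure_pmf.prob M {X. e \<in> X}) \<bind>
       (\<lambda>v. map_pmf (\<lambda>X. if v then insert e X else X) (if v then MT else MF))"
    "set_pmf MT \<union> set_pmf MF \<subseteq> (\<lambda>X. X - {e}) ` set_pmf M"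
proof -
  define a where "a = measure_pmf.prob M {X. e \<in> X}"
  define C where "C v = {X. (e \<in> X) = v}" for v
  define ok where "ok v \<longleftrightarrow> set_pmf M \<inter> C v \<noteq> {}" for v
  define K where "K v = map_pmf (\<lambda>X. X - {e}) (cond_pmf M (C v))" for v
  \<comment> \<open>If \<open>e\<close> is almost surely present or almost surely absent, one
    conditional law does not exist. The other one replaces it: it gets weight 0, and its support is
    still a projection of the support of \<open>M\<close>, so absolute continuity is
    inherited.\<close>
  define L where "L v = (if ok v then K v else K (\<not> v))" for v
  have ok_or: "ok v \<or> ok (\<not> v)" for v
  proof -
    obtain X where "X \<in> set_pmf M" using set_pmf_not_empty[of M] by auto
    then show ?thesis by (auto simp: ok_def C_def)
  qed
  have set_K: "set_pmf (K v) \<subseteq> (\<lambda>X. X - {e}) ` set_pmf M" if "ok v" for v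
    using that by (auto simp: K_def ok_def set_cond_pmf)
  have set_L: "set_pmf (L v) \<subseteq> (\<lambda>X. X - {e}) ` set_pmf M" for v
    using set_K[of v] set_K[of "\<not> v"] ok_or[of v] unfolding L_def by presburger
  have a01: "0 \<le> a" "a \<le> 1" by (simp_all add: a_def)
  have b: "map_pmf (\<lambda>X. e \<in> X) M = bernoulli_pmf a"
  proof (rule pmf_eqI)
    have "pmf (map_pmf (\<lambda>X. e \<in> X) M) True = pmf (bernoulli_pmf a) True"
      using a01 by (simp add: pmf_map a_def vimage_def)
    then show "pmf (map_pmf (\<lambda>X. e \<in> X) M) v = pmf (bernoulli_pmf a) v" for v
      by (metis (full_types) pmf_False_conv_True)
  qed
  have L_if: "(if v then L True else L False) = L v" for v by simp
  have "M = map_pmf (\<lambda>X. e \<in> X) M \<bind> (\<lambda>v. cond_pmf M {X. (e \<in> X) = v})"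
    by (rule bind_cond_pmf_cancel[symmetric]) (auto simp: vimage_def)
  also have "\<dots> = map_pmf (\<lambda>X. e \<in> X) M \<bind> (\<lambda>v. map_pmf (\<lambda>X. if v then insert e X else X) (L v))"
  proof (rule bind_pmf_cong[OF refl])
    fix v assume "v \<in> set_pmf (map_pmf (\<lambda>X. e \<in> X) M)"
    then have ok: "set_pmf M \<inter> C v \<noteq> {}" by (auto simp: C_def)
    have "map_pmf (\<lambda>X. if v then insert e X else X) (L v) = map_pmf (\<lambda>X. if v then insert e (X - {e}) else X - {e}) (cond_pmf M (C v))"
      using ok by (simp add: L_def ok_def K_def map_pmf_comp)
    also have "\<dots> = cond_pmf M (C v)"
      by (rule map_pmf_idI) (use ok in \<open>auto simp: set_cond_pmf C_def\<close>)
    finally show "cond_pmf M {X. (e \<in> X) = v} = map_pmf (\<lambda>X. if v then insert e X else X) (L v)"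
      by (simp add: C_def)
  qed
  finally have "M = bernoulli_pmf a \<bind> (\<lambda>v. map_pmf (\<lambda>X. if v then insert e X else X) (if v then L True else L False))"
    unfolding b L_if .
  then show ?thesis unfolding a_def using set_L by (intro that[of "L True" "L False"]) auto
qed

section \<open>Hamming distance and Marton's coupling\<close>

definition set_dist :: "'a set \<Rightarrow> 'a set \<Rightarrow> real" where
  "set_dist X Y = real (card ((X - Y) \<union> (Y - X)))"

lemma set_dist_insert:
  assumes "finite E" "e \<notin> E" "X \<subseteq> E" "Y \<subseteq> E"
  shows "set_dist (if x then insert e X else X) (if y then insert e Y else Y) = of_bool (x \<noteq> y) + set_dist X Y"
proof -
  have *: "e \<notin> X" "e \<notin> Y" "finite X" "finite Y" using assms by (auto dest: finite_subset)
  have 1: "insert e X - insert e Y \<union> (insert e Y - insert e X) = X - Y \<union> (Y - X)" using * by auto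
  have 2: "insert e X - Y \<union> (Y - insert e X) = insert e (X - Y \<union> (Y - X))" using * by auto
  have 3: "X - insert e Y \<union> (insert e Y - X) = insert e (X - Y \<union> (Y - X))" using * by auto
  have e: "e \<notin> X - Y \<union> (Y - X)" and fin: "finite (X - Y \<union> (Y - X))" using * by auto
  show ?thesis
    unfolding set_dist_def using e fin
    by (cases x; cases y) (simp_all only: 1 2 3 if_True if_False card_insert_disjoint, simp_all)
qed

text \<open>Marton's coupling: reveal the elements one at a time and couple each new indicator optimally.
  The quantifier over \<^term>\<open>c\<close> encodes a square-root bound in a form that is linear in the
  relative entropy and hence stable under averaging.\<close>
lemma marton_coupling:
  assumes "finite E" "\<And>u. u \<in> E \<Longrightarrow> 0 \<le> p u \<and> p u \<le> 1" "set_pmf M \<subseteq> Pow E"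
    and "\<And>X u. X \<in> set_pmf M \<Longrightarrow> u \<in> E \<Longrightarrow> (p u = 0 \<longrightarrow> u \<notin> X) \<and> (p u = 1 \<longrightarrow> u \<in> X)"
  shows "\<exists>Q. map_pmf fst Q = M \<and> map_pmf snd Q = indep_set E p \<and>
    (\<forall>c>0. measure_pmf.expectation Q (\<lambda>(X, Y). set_dist X Y) \<le> (c * real (card E) + kl_indep M E p / c) / 2)"
  using assms
proof (induction E arbitrary: M rule: finite_induct)
  case empty
  have "M = return_pmf {}"
    using empty.prems(2) by (metis Pow_empty set_pmf_subset_singleton)
  moreover have "indep_set {} p = return_pmf {}" by (simp add: indep_set_def)
  ultimately show ?case
    by (intro exI[of _ "return_pmf ({}, {})"]) (simp add: kl_indep_def set_dist_def)
next
  case (insert e E)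
  define a where "a = measure_pmf.prob M {X. e \<in> X}"
  obtain MT MF where M: "M = bernoulli_pmf a \<bind>
       (\<lambda>v. map_pmf (\<lambda>X. if v then insert e X else X) (if v then MT else MF))"
    and set_M: "set_pmf MT \<union> set_pmf MF \<subseteq> (\<lambda>X. X - {e}) ` set_pmf M"
    unfolding a_def by (rule reveal_element)
  have a01: "0 \<le> a" "a \<le> 1" by (simp_all add: a_def)
  let ?ins = "\<lambda>v X. if v then insert e X else X"
  define M' where "M' v = (if v then MT else MF)" for v
  have M': "M = bernoulli_pmf a \<bind> (\<lambda>v. map_pmf (?ins v) (M' v))"
    using M by (simp add: M'_def)
  have supp: "set_pmf (M' v) \<subseteq> Pow E" for v
  proof -
    have "(\<lambda>X. X - {e}) ` set_pmf M \<subseteq> Pow E" using insert.prems(2) by auto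
    moreover have "set_pmf (M' v) \<subseteq> set_pmf MT \<union> set_pmf MF" by (simp add: M'_def)
    ultimately show ?thesis using set_M by (meson order_trans)
  qed
  have abs_cont: "(p u = 0 \<longrightarrow> u \<notin> X) \<and> (p u = 1 \<longrightarrow> u \<in> X)" if X: "X \<in> set_pmf (M' v)" and u: "u \<in> E" for X u v
  proof -
    obtain Z where Z: "Z \<in> set_pmf M" "X = Z - {e}" using set_M X by (auto simp: M'_def split: if_splits)
    with u insert.hyps(2) insert.prems(3)[of Z u] show ?thesis by auto
  qed
  have "\<exists>Q. map_pmf fst Q = M' v \<and> map_pmf snd Q = indep_set E p \<and>
    (\<forall>c>0. measure_pmf.expectation Q (\<lambda>(X, Y). set_dist X Y) \<le> (c * real (card E) + kl_indep (M' v) E p / c) / 2)" for v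
    by (rule insert.IH) (use insert.prems(1) supp abs_cont in auto)
  then obtain Q' where Q': "\<And>v. map_pmf fst (Q' v) = M' v" "\<And>v. map_pmf snd (Q' v) = indep_set E p"
    and dQ': "\<And>v c. 0 < c \<Longrightarrow> measure_pmf.expectation (Q' v) (\<lambda>(X, Y). set_dist X Y) \<le> (c * real (card E) + kl_indep (M' v) E p / c) / 2"
    by metis
  have set_Q': "set_pmf (Q' v) \<subseteq> Pow E \<times> Pow E" for v
  proof -
    have "fst ` set_pmf (Q' v) \<subseteq> Pow E" "snd ` set_pmf (Q' v) \<subseteq> Pow E"
      unfolding set_map_pmf[symmetric] Q' using supp set_indep_set[OF insert.hyps(1)] by auto
    then show ?thesis unfolding image_subset_iff by (intro subsetI) (simp add: mem_Times_iff)
  qed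
  have fin_Q': "finite (set_pmf (Q' v))" for v
    using finite_subset[OF set_Q'] insert.hyps(1) by simp
  have pe: "0 \<le> p e" "p e \<le> 1" using insert.prems(1) by auto
  obtain R where R: "map_pmf fst R = bernoulli_pmf a" "map_pmf snd R = bernoulli_pmf (p e)"
    "measure_pmf.expectation R (\<lambda>(x, y). of_bool (x \<noteq> y)) = \<bar>a - p e\<bar>"
    using bernoulli_coupling[OF a01 pe] by blast
  \<comment> \<open>The two bits come from the maximal coupling; the rest is coupled given only the
    bit \<open>v\<close> of \<open>M\<close>. This gives the right second marginal because under the
    product measure the rest has law \<open>indep_set E p\<close> whatever \<open>y\<close>
    is.\<close>
  define Q where "Q = R \<bind> (\<lambda>(v, y). map_pmf (\<lambda>(X, Y). (?ins v X, ?ins y Y)) (Q' v))"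
  have "map_pmf fst Q = R \<bind> (\<lambda>(v, y). map_pmf (?ins v) (map_pmf fst (Q' v)))"
    by (simp add: Q_def map_bind_pmf map_pmf_comp case_prod_unfold)
  also have "\<dots> = map_pmf fst R \<bind> (\<lambda>v. map_pmf (?ins v) (M' v))"
    by (simp add: bind_map_pmf Q' case_prod_unfold)
  finally have fst_Q: "map_pmf fst Q = M" unfolding R M'[symmetric] .
  have "map_pmf snd Q = R \<bind> (\<lambda>(v, y). map_pmf (?ins y) (map_pmf snd (Q' v)))"
    by (simp add: Q_def map_bind_pmf map_pmf_comp case_prod_unfold)
  also have "\<dots> = map_pmf snd R \<bind> (\<lambda>y. map_pmf (?ins y) (indep_set E p))"
    by (simp add: bind_map_pmf Q' case_prod_unfold)
  finally have snd_Q: "map_pmf snd Q = indep_set (insert e E) p"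
    unfolding R indep_set_insert[OF insert.hyps] .
  have pmf_M: "pmf M Z = a * measure_pmf.prob MT (?ins True -` {Z}) + (1 - a) * measure_pmf.prob MF (?ins False -` {Z})" for Z
    using a01 by (subst M) (simp add: pmf_bind pmf_map)
  have T: "pmf M (insert e X) = a * pmf MT X" if "X \<subseteq> E" for X
  proof -
    \<comment> \<open>The preimage of \<open>insert e X\<close> also contains
      \<open>insert e X\<close> itself, but \<open>MT\<close> gives no mass to sets containing
      \<open>e\<close>.\<close>
    have "measure_pmf.prob MT (?ins True -` {insert e X}) = measure_pmf.prob MT {X}"
    proof (intro measure_pmf.finite_measure_eq_AE)
      have "Y \<in> ?ins True -` {insert e X} \<longleftrightarrow> Y \<in> {X}" if "Y \<in> set_pmf MT" for Y
      proof -
        have "e \<notin> X" "e \<notin> Y" using \<open>X \<subseteq> E\<close> that supp[of True] insert.hyps(2) by (auto simp: M'_def)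
        then show ?thesis by (simp add: insert_ident)
      qed
      then show "AE Y in measure_pmf MT. Y \<in> ?ins True -` {insert e X} \<longleftrightarrow> Y \<in> {X}"
        by (simp add: AE_measure_pmf_iff)
    qed auto
    moreover have "measure_pmf.prob MF (?ins False -` {insert e X}) = 0"
      using supp[of False] insert.hyps(2)
      by (auto simp: measure_pmf_zero_iff M'_def)
    ultimately show ?thesis by (simp add: pmf_M measure_pmf_single)
  qed
  have F: "pmf M X = (1 - a) * pmf MF X" if "X \<subseteq> E" for X
  proof -
    have "measure_pmf.prob MT (?ins True -` {X}) = 0"
      using that insert.hyps(2) by (auto simp: measure_pmf_zero_iff)
    moreover have "?ins False -` {X} = {X}" by auto
    ultimately show ?thesis by (simp add: pmf_M measure_pmf_single)
  qed
  have kl: "kl_indep M (insert e E) p = bernoulli_kl a (p e) + a * kl_indep (M' True) E p + (1 - a) * kl_indep (M' False) E p"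
    unfolding M'_def if_True if_False
    by (rule kl_indep_insert) (use insert.hyps a01 T F supp[of True] supp[of False] in \<open>auto simp: M'_def\<close>)
  let ?D = "\<lambda>v. measure_pmf.expectation (Q' v) (\<lambda>(X, Y). set_dist X Y)"
  have "measure_pmf.expectation Q (\<lambda>(X, Y). set_dist X Y) = (\<Sum>z\<in>UNIV. pmf R z * (of_bool (fst z \<noteq> snd z) + ?D (fst z)))"
  proof -
    have "measure_pmf.expectation (Q' v) (\<lambda>z. set_dist (?ins v (fst z)) (?ins y (snd z))) = of_bool (v \<noteq> y) + ?D v" for v y
    proof -
      have "measure_pmf.expectation (Q' v) (\<lambda>z. set_dist (?ins v (fst z)) (?ins y (snd z)))
          = measure_pmf.expectation (Q' v) (\<lambda>z. of_bool (v \<noteq> y) + set_dist (fst z) (snd z))"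
      proof (intro integral_cong_AE)
        have "set_dist (?ins v (fst z)) (?ins y (snd z)) = of_bool (v \<noteq> y) + set_dist (fst z) (snd z)"
          if "z \<in> set_pmf (Q' v)" for z
          by (rule set_dist_insert[OF insert.hyps]) (use subsetD[OF set_Q' that] in \<open>auto simp: mem_Times_iff\<close>)
        then show "AE z in measure_pmf (Q' v). set_dist (?ins v (fst z)) (?ins y (snd z)) = of_bool (v \<noteq> y) + set_dist (fst z) (snd z)"
          unfolding AE_measure_pmf_iff by blast
      qed auto
      also have "\<dots> = of_bool (v \<noteq> y) + ?D v"
        by (subst Bochner_Integration.integral_add)
           (auto intro!: integrable_measure_pmf_finite fin_Q' simp: case_prod_unfold)
      finally show ?thesis .
    qed
    then show ?thesis
      unfolding Q_def using fin_Q'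
      by (subst pmf_expectation_bind[of UNIV]) (auto simp: case_prod_unfold)
  qed
  also have "\<dots> = (\<Sum>z\<in>UNIV. pmf R z * of_bool (fst z \<noteq> snd z)) + (\<Sum>z\<in>UNIV. pmf R z * ?D (fst z))"
    by (simp add: distrib_left sum.distrib)
  also have "(\<Sum>z\<in>UNIV. pmf R z * of_bool (fst z \<noteq> snd z)) = \<bar>a - p e\<bar>"
    unfolding R(3)[symmetric] by (subst integral_measure_pmf[of UNIV]) (auto simp: case_prod_unfold)
  also have "(\<Sum>z\<in>UNIV. pmf R z * ?D (fst z)) = measure_pmf.expectation (map_pmf fst R) ?D"
    by (simp, subst integral_measure_pmf[of UNIV]) auto
  also have "\<dots> = a * ?D True + (1 - a) * ?D False"
    unfolding R(1) using a01 by simp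
  finally have EQ: "measure_pmf.expectation Q (\<lambda>(X, Y). set_dist X Y) = \<bar>a - p e\<bar> + (a * ?D True + (1 - a) * ?D False)" .
  have "measure_pmf.expectation Q (\<lambda>(X, Y). set_dist X Y) \<le> (c * real (card (insert e E)) + kl_indep M (insert e E) p / c) / 2"
    if c: "c > 0" for c
  proof -
    have abs0: "p e = 0 \<Longrightarrow> a = 0"
      using insert.prems(3)[of _ e] by (auto simp: a_def measure_pmf_zero_iff)
    have abs1: "a = 1" if "p e = 1"
    proof -
      have "measure_pmf.prob M {X. e \<in> X} = measure_pmf.prob M UNIV"
        using insert.prems(3)[of _ e] that by (intro measure_pmf.finite_measure_eq_AE) (auto simp: AE_measure_pmf_iff)
      then show ?thesis by (simp add: a_def)
    qed
    have "(a - p e)\<^sup>2 \<le> bernoulli_kl a (p e)"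
      by (rule bernoulli_kl_ge) (use a01 pe abs0 abs1 in auto)
    then have "(a - p e)\<^sup>2 / c \<le> bernoulli_kl a (p e) / c" using c by (intro divide_right_mono) auto
    \<comment> \<open>The same \<open>c\<close> is used for every element, so the first terms add up
      to \<open>c * card E\<close> while the divergences add up by the chain rule.\<close>
    then have "2 * \<bar>a - p e\<bar> \<le> c + bernoulli_kl a (p e) / c"
      by (intro order_trans[OF abs_le_amgm[OF c, of "a - p e"]] add_left_mono)
    then have "\<bar>a - p e\<bar> \<le> (c + bernoulli_kl a (p e) / c) / 2" by simp
    moreover have "a * ?D True \<le> a * ((c * real (card E) + kl_indep (M' True) E p / c) / 2)"
      using dQ'[OF c] a01 by (intro mult_left_mono) auto
    moreover have "(1 - a) * ?D False \<le> (1 - a) * ((c * real (card E) + kl_indep (M' False) E p / c) / 2)"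
      using dQ'[OF c] a01 by (intro mult_left_mono) auto
    ultimately have "measure_pmf.expectation Q (\<lambda>(X, Y). set_dist X Y) \<le>
        (c + bernoulli_kl a (p e) / c) / 2 + (a * ((c * real (card E) + kl_indep (M' True) E p / c) / 2)
         + (1 - a) * ((c * real (card E) + kl_indep (M' False) E p / c) / 2))"
      unfolding EQ by linarith
    also have "\<dots> = (c * real (card (insert e E)) + kl_indep M (insert e E) p / c) / 2"
      using insert.hyps c by (simp add: kl field_simps)
    finally show ?thesis .
  qed
  then show ?case using fst_Q snd_Q by blast
qed

section \<open>Gibbs measures and mixtures of product measures\<close>

text \<open>Nonnegativity of relative entropy, termwise from \<open>ln t \<le> t - 1\<close> at
  \<open>t = b x / a x\<close>.\<close>

lemma gibbs_inequality:
  fixes a b :: "'x \<Rightarrow> real"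
  assumes "\<And>x. x \<in> S \<Longrightarrow> 0 \<le> a x" "\<And>x. x \<in> S \<Longrightarrow> 0 < b x" "sum b S \<le> sum a S"
  shows "(\<Sum>x\<in>S. a x * ln (b x)) \<le> (\<Sum>x\<in>S. a x * ln (a x))"
proof -
  have "a x * ln (b x) - a x * ln (a x) \<le> b x - a x" if "x \<in> S" for x
  proof (cases "a x = 0")
    case True
    then show ?thesis using assms(2)[OF that] by simp
  next
    case False
    then have pos: "0 < a x" "0 < b x" using assms that by (auto simp: le_less)
    have "a x * ln (b x / a x) \<le> a x * (b x / a x - 1)"
      using pos by (intro mult_left_mono ln_le_minus_one) auto
    then show ?thesis using pos by (simp add: ln_div algebra_simps)
  qed
  then have "(\<Sum>x\<in>S. a x * ln (b x) - a x * ln (a x)) \<le> (\<Sum>x\<in>S. b x - a x)"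
    by (rule sum_mono)
  then show ?thesis using assms(3) by (simp add: sum_subtractf)
qed

lemma entropy_le_ln_card:
  fixes a :: "'x \<Rightarrow> real"
  assumes "finite S" "S \<noteq> {}" "\<And>x. x \<in> S \<Longrightarrow> 0 \<le> a x" "sum a S = 1"
  shows "- (\<Sum>x\<in>S. a x * ln (a x)) \<le> ln (real (card S))"
proof -
  have pos: "0 < real (card S)" using assms by (simp add: card_gt_0_iff)
  have "(\<Sum>x\<in>S. a x * ln (1 / real (card S))) \<le> (\<Sum>x\<in>S. a x * ln (a x))"
    using assms pos by (intro gibbs_inequality) auto
  then show ?thesis using assms(4) pos by (simp add: ln_div sum_negf flip: sum_distrib_right)
qed

text \<open>Merging atoms can only lower entropy. This is used to pass from the joint law of label
  and graph to the law of the graph.\<close>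

lemma sum_xlnx_le:
  fixes a :: "'x \<Rightarrow> real"
  assumes "finite S" "\<And>x. x \<in> S \<Longrightarrow> 0 \<le> a x"
  shows "(\<Sum>x\<in>S. a x * ln (a x)) \<le> sum a S * ln (sum a S)"
  unfolding sum_distrib_right
proof (rule sum_mono)
  fix x assume x: "x \<in> S"
  show "a x * ln (a x) \<le> a x * ln (sum a S)"
  proof (cases "a x = 0")
    case False
    then have "0 < a x" using assms(2)[OF x] by simp
    moreover have "a x \<le> sum a S" using assms x by (intro member_le_sum) auto
    ultimately show ?thesis by (intro mult_left_mono) auto
  qed simp
qed

lemma sum_pmf_of_bool:
  assumes "finite A" "set_pmf M \<subseteq> A"
  shows "(\<Sum>X\<in>A. pmf M X * of_bool (P X)) = measure_pmf.prob M {X. P X}"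
proof -
  have "measure_pmf.expectation M (indicator {X. P X}) = (\<Sum>X\<in>A. pmf M X *\<^sub>R (indicator {X. P X} X :: real))"
    using assms by (intro integral_measure_pmf) auto
  then show ?thesis by (simp add: indicator_def)
qed

text \<open>The log density is affine in the indicators \<open>u \<in> X\<close>, so
  \<open>M\<close> enters only through its marginals.\<close>

lemma sum_pmf_indep_log:
  assumes "finite E" "set_pmf M \<subseteq> Pow E"
  shows "(\<Sum>X\<in>Pow E. pmf M X * (\<Sum>u\<in>E. ln (if u \<in> X then p u else 1 - p u)))
    = (\<Sum>u\<in>E. measure_pmf.prob M {X. u \<in> X} * ln (p u) + (1 - measure_pmf.prob M {X. u \<in> X}) * ln (1 - p u))"
proof -
  have "(\<Sum>X\<in>Pow E. pmf M X * ln (if u \<in> X then p u else 1 - p u))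
      = measure_pmf.prob M {X. u \<in> X} * ln (p u) + (1 - measure_pmf.prob M {X. u \<in> X}) * ln (1 - p u)" for u
  proof -
    have prob: "(\<Sum>X\<in>Pow E. pmf M X * of_bool (u \<in> X)) = measure_pmf.prob M {X. u \<in> X}"
      using assms by (intro sum_pmf_of_bool) auto
    have "(\<Sum>X\<in>Pow E. pmf M X * ln (if u \<in> X then p u else 1 - p u))
        = (\<Sum>X\<in>Pow E. pmf M X * of_bool (u \<in> X) * (ln (p u) - ln (1 - p u)) + pmf M X * ln (1 - p u))"
      by (intro sum.cong) (auto simp: algebra_simps)
    also have "\<dots> = measure_pmf.prob M {X. u \<in> X} * (ln (p u) - ln (1 - p u)) + ln (1 - p u)"
      using sum_pmf_eq_1[OF _ assms(2)] assms(1)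
      by (simp add: sum.distrib prob flip: sum_distrib_right)
    finally show ?thesis by (simp add: algebra_simps)
  qed
  then show ?thesis
    unfolding sum_distrib_left by (subst sum.swap) simp
qed

lemma indep_set_entropy:
  assumes "finite E" "\<And>u. u \<in> E \<Longrightarrow> 0 \<le> p u \<and> p u \<le> 1"
  shows "(\<Sum>X\<in>Pow E. pmf (indep_set E p) X * ln (pmf (indep_set E p) X))
    = (\<Sum>u\<in>E. p u * ln (p u) + (1 - p u) * ln (1 - p u))"
proof -
  let ?q = "indep_set E p"
  have "pmf ?q X * ln (pmf ?q X) = pmf ?q X * (\<Sum>u\<in>E. ln (if u \<in> X then p u else 1 - p u))" if "X \<in> Pow E" for X
  proof (cases "pmf ?q X = 0")
    case False
    then have q: "(\<Prod>u\<in>E. if u \<in> X then p u else 1 - p u) \<noteq> 0" "pmf ?q X = (\<Prod>u\<in>E. if u \<in> X then p u else 1 - p u)"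
      using that assms by (auto simp: pmf_indep_set split: if_splits)
    have nz: "(if u \<in> X then p u else 1 - p u) \<noteq> 0" if "u \<in> E" for u
      using q(1) assms(1) that by simp
    show ?thesis unfolding q(2) by (subst ln_prod[OF assms(1) nz]) simp_all
  qed simp
  then have "(\<Sum>X\<in>Pow E. pmf ?q X * ln (pmf ?q X)) = (\<Sum>X\<in>Pow E. pmf ?q X * (\<Sum>u\<in>E. ln (if u \<in> X then p u else 1 - p u)))"
    by (rule sum.cong[OF refl])
  also have "\<dots> = (\<Sum>u\<in>E. p u * ln (p u) + (1 - p u) * ln (1 - p u))"
    unfolding sum_pmf_indep_log[OF assms(1) set_indep_set[OF assms(1)]]
    by (intro sum.cong refl) (use assms in \<open>simp add: prob_in_indep_set\<close>)
  finally show ?thesis .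
qed

text \<open>Hamiltonian and label are arbitrary here; the price of the label is the logarithm of the
  number of its values.\<close>

locale labelled_gibbs =
  fixes E :: "'a set" and f :: "'a set \<Rightarrow> real" and M :: "'a set pmf" and Y :: "'a set \<Rightarrow> 'y"
  assumes finite_E: "finite E"
    and pmf_M: "\<And>X. pmf M X = (if X \<subseteq> E then exp (f X) / (\<Sum>X\<in>Pow E. exp (f X)) else 0)"
begin

text \<open>Expressed through \<open>cond_mean\<close> so that \<open>max_corr\<close> measures
  exactly the deviation from these probabilities.\<close>

definition marginal :: "'y \<Rightarrow> 'a \<Rightarrow> real" where
  "marginal y u = cond_mean (pmf M) (Pow E) Y (\<lambda>X. of_bool (u \<in> X)) y"

definition mixture :: "'a set pmf" where
  "mixture = map_pmf Y M \<bind> (\<lambda>y. indep_set E (marginal y))"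

abbreviation "labels \<equiv> Y ` Pow E"

definition slice :: "'y \<Rightarrow> 'a set pmf" where
  "slice y = cond_pmf M {X. Y X = y}"

lemma partition_function_pos: "0 < (\<Sum>X\<in>Pow E. exp (f X))"
  using finite_E by (intro sum_pos) auto

lemma set_M: "set_pmf M = Pow E"
  using partition_function_pos by (auto simp: set_pmf_eq pmf_M)

lemma finite_Pow_E: "finite (Pow E)" and finite_labels: "finite labels" and labels_nonempty: "labels \<noteq> {}"
  using finite_E by auto

lemma marginal_bounds: "0 \<le> marginal y u" "marginal y u \<le> 1"
  unfolding marginal_def using finite_Pow_E by (auto intro!: cond_mean_bounds)

lemma pmf_label: "pmf (map_pmf Y M) y = (\<Sum>X\<in>{X\<in>Pow E. Y X = y}. pmf M X)"
proof -
  have "measure_pmf.prob M (Y -` {y}) = measure_pmf.prob M {X\<in>Pow E. Y X = y}"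
    using set_M by (intro measure_pmf.finite_measure_eq_AE) (auto simp: AE_measure_pmf_iff)
  then show ?thesis
    using finite_Pow_E by (simp add: pmf_map measure_measure_pmf_finite)
qed

lemma set_label: "set_pmf (map_pmf Y M) = labels"
  by (simp add: set_M)

lemma label_pos: "y \<in> labels \<Longrightarrow> 0 < pmf (map_pmf Y M) y"
  by (metis pmf_positive set_label)

lemma sum_label:
  "(\<Sum>X\<in>Pow E. pmf M X * h (Y X)) = (\<Sum>y\<in>labels. pmf (map_pmf Y M) y * h y)" for h :: "'y \<Rightarrow> real"
  unfolding sum_fibres[OF finite_Pow_E, of _ Y] pmf_label sum_distrib_right
  by (intro sum.cong) auto

lemma slice_nonempty: "y \<in> labels \<Longrightarrow> set_pmf M \<inter> {X. Y X = y} \<noteq> {}"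
  unfolding set_M by auto

lemma pmf_slice: "y \<in> labels \<Longrightarrow> pmf (slice y) X = (if Y X = y then pmf M X / pmf (map_pmf Y M) y else 0)"
  unfolding slice_def by (simp add: pmf_cond[OF slice_nonempty] pmf_map vimage_def)

lemma set_slice: "y \<in> labels \<Longrightarrow> set_pmf (slice y) \<subseteq> Pow E"
  unfolding slice_def using set_cond_pmf[OF slice_nonempty] set_M by auto

lemma M_eq_bind_slice: "map_pmf Y M \<bind> slice = M"
  unfolding slice_def by (rule bind_cond_pmf_cancel) (auto simp: vimage_def)

text \<open>The conditioned law and its product measure share their marginals, which turns their
  relative entropy into a difference of entropies.\<close>

lemma prob_slice:
  assumes "y \<in> labels"
  shows "measure_pmf.prob (slice y) {X. u \<in> X} = marginal y u"
proof -
  have "measure_pmf.prob (slice y) {X. u \<in> X} = (\<Sum>X\<in>Pow E. pmf (slice y) X * of_bool (u \<in> X))"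
    using finite_Pow_E set_slice[OF assms] by (rule sum_pmf_of_bool[symmetric])
  also have "\<dots> = (\<Sum>X\<in>{X\<in>Pow E. Y X = y}. pmf M X / pmf (map_pmf Y M) y * of_bool (u \<in> X))"
    using finite_Pow_E by (intro sum.mono_neutral_cong_right) (auto simp: pmf_slice[OF assms])
  also have "\<dots> = marginal y u"
    unfolding marginal_def cond_mean_def pmf_label by (simp add: sum_divide_distrib)
  finally show ?thesis .
qed

text \<open>Chain rule for entropy: the label is a function of \<open>X\<close>, so the entropy of
  \<open>M\<close> is that of the label plus the mean entropy of the slices.\<close>

lemma sum_slice_xlnx:
  "(\<Sum>y\<in>labels. pmf (map_pmf Y M) y * (\<Sum>X\<in>Pow E. pmf (slice y) X * ln (pmf (slice y) X)))
   = (\<Sum>X\<in>Pow E. pmf M X * ln (pmf M X)) - (\<Sum>y\<in>labels. pmf (map_pmf Y M) y * ln (pmf (map_pmf Y M) y))"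
proof -
  have *: "pmf (map_pmf Y M) y * (\<Sum>X\<in>Pow E. pmf (slice y) X * ln (pmf (slice y) X))
     = (\<Sum>X\<in>{X\<in>Pow E. Y X = y}. pmf M X * (ln (pmf M X) - ln (pmf (map_pmf Y M) (Y X))))" if y: "y \<in> labels" for y
  proof -
    have "pmf (map_pmf Y M) y * (\<Sum>X\<in>Pow E. pmf (slice y) X * ln (pmf (slice y) X))
       = (\<Sum>X\<in>Pow E. pmf (map_pmf Y M) y * (pmf (slice y) X * ln (pmf (slice y) X)))"
      by (rule sum_distrib_left)
    also have "\<dots> = (\<Sum>X\<in>{X\<in>Pow E. Y X = y}. pmf M X * (ln (pmf M X) - ln (pmf (map_pmf Y M) (Y X))))"
    proof (rule sum.mono_neutral_cong_right)
      fix X assume X: "X \<in> {X \<in> Pow E. Y X = y}"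
      then have "0 < pmf M X" using set_M by (intro pmf_positive) auto
      then show "pmf (map_pmf Y M) y * (pmf (slice y) X * ln (pmf (slice y) X))
          = pmf M X * (ln (pmf M X) - ln (pmf (map_pmf Y M) (Y X)))"
        using X label_pos[OF y] unfolding pmf_slice[OF y] by (simp add: ln_div)
    qed (use finite_Pow_E in \<open>auto simp: pmf_slice[OF y]\<close>)
    finally show ?thesis .
  qed
  have "(\<Sum>y\<in>labels. pmf (map_pmf Y M) y * (\<Sum>X\<in>Pow E. pmf (slice y) X * ln (pmf (slice y) X)))
     = (\<Sum>y\<in>labels. \<Sum>X\<in>{X\<in>Pow E. Y X = y}. pmf M X * (ln (pmf M X) - ln (pmf (map_pmf Y M) (Y X))))"
    by (rule sum.cong[OF refl], rule *)
  also have "\<dots> = (\<Sum>X\<in>Pow E. pmf M X * (ln (pmf M X) - ln (pmf (map_pmf Y M) (Y X))))"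
    by (rule sum_fibres[OF finite_Pow_E, symmetric])
  also have "\<dots> = (\<Sum>X\<in>Pow E. pmf M X * ln (pmf M X)) - (\<Sum>X\<in>Pow E. pmf M X * ln (pmf (map_pmf Y M) (Y X)))"
    by (simp add: right_diff_distrib sum_subtractf)
  finally show ?thesis unfolding sum_label[where h = "\<lambda>y. ln (pmf (map_pmf Y M) y)"] .
qed

lemma label_entropy_le: "- (\<Sum>y\<in>labels. pmf (map_pmf Y M) y * ln (pmf (map_pmf Y M) y)) \<le> ln (real (card labels))"
  using finite_labels labels_nonempty set_label
  by (intro entropy_le_ln_card) (auto intro!: sum_pmf_eq_1)

text \<open>The Gibbs variational principle, applied to each product measure separately.\<close>
lemma kl_slice_le:
  assumes "y \<in> labels"
  shows "kl_indep (slice y) E (marginal y) \<le> (\<Sum>X\<in>Pow E. pmf (slice y) X * ln (pmf (slice y) X))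
     + ln (\<Sum>X\<in>Pow E. exp (f X)) - (\<Sum>G\<in>Pow E. pmf (indep_set E (marginal y)) G * f G)"
proof -
  let ?q = "indep_set E (marginal y)" and ?Z = "\<Sum>X\<in>Pow E. exp (f X)"
  have "(\<Sum>G\<in>Pow E. pmf ?q G * ln (exp (f G) / ?Z)) \<le> (\<Sum>G\<in>Pow E. pmf ?q G * ln (pmf ?q G))"
    using partition_function_pos sum_pmf_eq_1[OF finite_Pow_E set_indep_set[OF finite_E]]
    by (intro gibbs_inequality) (auto simp flip: sum_divide_distrib)
  moreover have "(\<Sum>G\<in>Pow E. pmf ?q G * ln (exp (f G) / ?Z)) = (\<Sum>G\<in>Pow E. pmf ?q G * f G) - ln ?Z"
    using partition_function_pos sum_pmf_eq_1[OF finite_Pow_E set_indep_set[OF finite_E]]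
    by (simp add: ln_div right_diff_distrib sum_subtractf flip: sum_distrib_right)
  \<comment> \<open>Equal marginals let the mean of the product log density under
    \<open>slice y\<close> be computed under \<open>?q\<close>, where it is minus the entropy of
    \<open>?q\<close>.\<close>
  moreover have "kl_indep (slice y) E (marginal y) = (\<Sum>X\<in>Pow E. pmf (slice y) X * ln (pmf (slice y) X))
     - (\<Sum>G\<in>Pow E. pmf ?q G * ln (pmf ?q G))"
    unfolding kl_indep_def right_diff_distrib sum_subtractf sum_pmf_indep_log[OF finite_E set_slice[OF assms]]
    using marginal_bounds by (simp add: prob_slice[OF assms] indep_set_entropy[OF finite_E])
  ultimately show ?thesis by linarith
qed

definition mean_field_gap :: real where
  "mean_field_gap = ln (real (card labels)) +
     (\<Sum>X\<in>Pow E. pmf M X * (f X - (\<Sum>G\<in>Pow E. pmf (indep_set E (marginal (Y X))) G * f G)))"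

lemma sum_kl_slice_le:
  "(\<Sum>y\<in>labels. pmf (map_pmf Y M) y * kl_indep (slice y) E (marginal y)) \<le> mean_field_gap"
proof -
  let ?Z = "\<Sum>X\<in>Pow E. exp (f X)"
  let ?F = "\<lambda>y. \<Sum>G\<in>Pow E. pmf (indep_set E (marginal y)) G * f G"
  have sumP: "(\<Sum>y\<in>labels. pmf (map_pmf Y M) y) = 1"
    using finite_labels set_label by (intro sum_pmf_eq_1) auto
  have sumM: "(\<Sum>X\<in>Pow E. pmf M X) = 1"
    using finite_Pow_E set_M by (intro sum_pmf_eq_1) auto
  have "(\<Sum>y\<in>labels. pmf (map_pmf Y M) y * kl_indep (slice y) E (marginal y))
     \<le> (\<Sum>y\<in>labels. pmf (map_pmf Y M) y * ((\<Sum>X\<in>Pow E. pmf (slice y) X * ln (pmf (slice y) X)) + ln ?Z - ?F y))"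
    by (intro sum_mono mult_left_mono kl_slice_le) auto
  also have "\<dots> = (\<Sum>y\<in>labels. pmf (map_pmf Y M) y * (\<Sum>X\<in>Pow E. pmf (slice y) X * ln (pmf (slice y) X)))
      + ln ?Z - (\<Sum>y\<in>labels. pmf (map_pmf Y M) y * ?F y)"
    using sumP by (simp add: right_diff_distrib distrib_left sum.distrib sum_subtractf flip: sum_distrib_right)
  also have "(\<Sum>y\<in>labels. pmf (map_pmf Y M) y * ?F y) = (\<Sum>X\<in>Pow E. pmf M X * ?F (Y X))"
    by (rule sum_label[symmetric])
  also have "(\<Sum>y\<in>labels. pmf (map_pmf Y M) y * (\<Sum>X\<in>Pow E. pmf (slice y) X * ln (pmf (slice y) X)))
      \<le> (\<Sum>X\<in>Pow E. pmf M X * ln (pmf M X)) + ln (real (card labels))"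
    unfolding sum_slice_xlnx using label_entropy_le by linarith
  \<comment> \<open>On the support \<open>ln (pmf M X) = f X - ln ?Z\<close>, which cancels the
    \<open>ln ?Z\<close> of the variational bound.\<close>
  also have "(\<Sum>X\<in>Pow E. pmf M X * ln (pmf M X)) = (\<Sum>X\<in>Pow E. pmf M X * (f X - ln ?Z))"
    using partition_function_pos by (intro sum.cong) (auto simp: pmf_M ln_div)
  also have "\<dots> = (\<Sum>X\<in>Pow E. pmf M X * f X) - ln ?Z"
    using sumM by (simp add: right_diff_distrib sum_subtractf flip: sum_distrib_right)
  finally show ?thesis
    unfolding mean_field_gap_def by (simp add: right_diff_distrib sum_subtractf)
qed

text \<open>Marton couplings are glued along the common label. Their bounds are linear in the
  relative entropy, so they average to the mean-field gap, and one coupling serves every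
  \<open>c\<close>.\<close>

theorem mixture_coupling:
  "\<exists>Q. map_pmf fst Q = M \<and> map_pmf snd Q = mixture \<and>
    (\<forall>c>0. measure_pmf.expectation Q (\<lambda>(X, Y). set_dist X Y) \<le> (c * real (card E) + mean_field_gap / c) / 2)"
proof -
  have "\<exists>Q. map_pmf fst Q = slice y \<and> map_pmf snd Q = indep_set E (marginal y) \<and>
    (\<forall>c>0. measure_pmf.expectation Q (\<lambda>(X, Y). set_dist X Y)
       \<le> (c * real (card E) + kl_indep (slice y) E (marginal y) / c) / 2)" if y: "y \<in> labels" for y
  proof (rule marton_coupling[OF finite_E])
    \<comment> \<open>Absolute continuity: an element of conditional probability 0 or 1 is decided
      on the whole support of the slice.\<close>
    fix X u assume X: "X \<in> set_pmf (slice y)"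
    have "u \<notin> X" if "marginal y u = 0"
      using that X unfolding prob_slice[OF y, symmetric] by (auto simp: measure_pmf_zero_iff)
    moreover have "u \<in> X" if "marginal y u = 1"
    proof -
      have "measure_pmf.prob (slice y) (space (measure_pmf (slice y)) - {X. u \<in> X}) = 0"
        using that unfolding prob_slice[OF y, symmetric] by (subst measure_pmf.prob_compl) auto
      then show ?thesis using X by (auto simp: measure_pmf_zero_iff)
    qed
    ultimately show "(marginal y u = 0 \<longrightarrow> u \<notin> X) \<and> (marginal y u = 1 \<longrightarrow> u \<in> X)" by blast
  qed (use marginal_bounds set_slice[OF y] in auto)
  then obtain Q where Q: "\<And>y. y \<in> labels \<Longrightarrow> map_pmf fst (Q y) = slice y"
    "\<And>y. y \<in> labels \<Longrightarrow> map_pmf snd (Q y) = indep_set E (marginal y)"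
    "\<And>y c. y \<in> labels \<Longrightarrow> 0 < c \<Longrightarrow> measure_pmf.expectation (Q y) (\<lambda>(X, Y). set_dist X Y)
       \<le> (c * real (card E) + kl_indep (slice y) E (marginal y) / c) / 2"
    by metis
  have set_Q: "set_pmf (Q y) \<subseteq> Pow E \<times> Pow E" if y: "y \<in> labels" for y
  proof -
    have "fst ` set_pmf (Q y) \<subseteq> Pow E" "snd ` set_pmf (Q y) \<subseteq> Pow E"
      unfolding set_map_pmf[symmetric] Q(1,2)[OF y] using set_slice[OF y] set_indep_set[OF finite_E] by auto
    then show ?thesis unfolding image_subset_iff by (intro subsetI) (simp add: mem_Times_iff)
  qed
  define QQ where "QQ = map_pmf Y M \<bind> Q"
  have "map_pmf fst QQ = map_pmf Y M \<bind> slice"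
    unfolding QQ_def map_bind_pmf by (rule bind_pmf_cong[OF refl]) (simp add: Q set_label del: set_map_pmf)
  then have fst_Q: "map_pmf fst QQ = M" unfolding M_eq_bind_slice .
  have snd_Q: "map_pmf snd QQ = mixture"
    unfolding QQ_def map_bind_pmf mixture_def
    by (rule bind_pmf_cong[OF refl]) (simp add: Q set_label del: set_map_pmf)
  have "measure_pmf.expectation QQ (\<lambda>(X, Y). set_dist X Y) \<le> (c * real (card E) + mean_field_gap / c) / 2" if c: "c > 0" for c
  proof -
    have sumP: "(\<Sum>y\<in>labels. pmf (map_pmf Y M) y) = 1"
      using finite_labels set_label by (intro sum_pmf_eq_1) auto
    have "measure_pmf.expectation QQ (\<lambda>(X, Y). set_dist X Y)
        = (\<Sum>y\<in>labels. pmf (map_pmf Y M) y * measure_pmf.expectation (Q y) (\<lambda>(X, Y). set_dist X Y))"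
      unfolding QQ_def using finite_labels set_label finite_subset[OF set_Q] finite_Pow_E
      by (subst pmf_expectation_bind[of labels]) auto
    also have "\<dots> \<le> (\<Sum>y\<in>labels. pmf (map_pmf Y M) y * ((c * real (card E) + kl_indep (slice y) E (marginal y) / c) / 2))"
      using Q(3) c by (intro sum_mono mult_left_mono) auto
    also have "\<dots> = (\<Sum>y\<in>labels. pmf (map_pmf Y M) y * (c * real (card E) / 2) + pmf (map_pmf Y M) y * kl_indep (slice y) E (marginal y) * (1 / c / 2))"
      by (intro sum.cong refl) (simp add: algebra_simps add_divide_distrib)
    also have "\<dots> = c * real (card E) / 2 + (\<Sum>y\<in>labels. pmf (map_pmf Y M) y * kl_indep (slice y) E (marginal y)) * (1 / c / 2)"
      by (simp only: sum.distrib sum_distrib_right[symmetric] sumP mult_1)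
    also have "\<dots> \<le> c * real (card E) / 2 + mean_field_gap * (1 / c / 2)"
      using sum_kl_slice_le c by (intro add_left_mono mult_right_mono) auto
    also have "\<dots> = (c * real (card E) + mean_field_gap / c) / 2"
      by (simp add: add_divide_distrib)
    finally show ?thesis .
  qed
  then show ?thesis using fst_Q snd_Q by blast
qed

lemma pmf_mixture: "pmf mixture G = (\<Sum>y\<in>labels. pmf (map_pmf Y M) y * pmf (indep_set E (marginal y)) G)"
  unfolding mixture_def pmf_bind
  by (subst integral_measure_pmf[OF finite_labels]) (auto simp: set_label simp del: set_map_pmf integral_map_pmf)

lemma set_mixture: "set_pmf mixture \<subseteq> Pow E"
  unfolding mixture_def using set_indep_set[OF finite_E] by auto

text \<open>The entropy of the mixture is at most the joint entropy of label and graph, that is,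
  label entropy plus mean entropy of the product measures.\<close>

lemma mixture_entropy_le:
  "- (\<Sum>G\<in>Pow E. pmf mixture G * ln (pmf mixture G))
   \<le> (\<Sum>y\<in>labels. pmf (map_pmf Y M) y * - (\<Sum>u\<in>E. marginal y u * ln (marginal y u) + (1 - marginal y u) * ln (1 - marginal y u)))
     + ln (real (card labels))"
proof -
  let ?P = "pmf (map_pmf Y M)" and ?q = "\<lambda>y. pmf (indep_set E (marginal y))"
  have "(\<Sum>y\<in>labels. ?P y * (\<Sum>G\<in>Pow E. ?q y G * ln (?q y G))) + (\<Sum>y\<in>labels. ?P y * ln (?P y))
      = (\<Sum>y\<in>labels. \<Sum>G\<in>Pow E. (?P y * ?q y G) * ln (?P y * ?q y G))"
    unfolding sum.distrib[symmetric]
  proof (rule sum.cong[OF refl])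
    fix y assume y: "y \<in> labels"
    have "(?P y * ?q y G) * ln (?P y * ?q y G) = ?P y * (?q y G * ln (?q y G)) + ?P y * ln (?P y) * ?q y G" for G
      using label_pos[OF y] by (cases "?q y G = 0") (auto simp: ln_mult algebra_simps less_le)
    then show "?P y * (\<Sum>G\<in>Pow E. ?q y G * ln (?q y G)) + ?P y * ln (?P y) = (\<Sum>G\<in>Pow E. (?P y * ?q y G) * ln (?P y * ?q y G))"
      using sum_pmf_eq_1[OF finite_Pow_E set_indep_set[OF finite_E]]
      by (simp add: sum.distrib flip: sum_distrib_left)
  qed
  also have "\<dots> = (\<Sum>G\<in>Pow E. \<Sum>y\<in>labels. (?P y * ?q y G) * ln (?P y * ?q y G))"
    by (rule sum.swap)
  also have "\<dots> \<le> (\<Sum>G\<in>Pow E. pmf mixture G * ln (pmf mixture G))"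
    unfolding pmf_mixture using finite_labels by (intro sum_mono sum_xlnx_le) auto
  finally show ?thesis
    using label_entropy_le marginal_bounds by (simp add: indep_set_entropy[OF finite_E] sum_negf)
qed

end

section \<open>Counting lemma\<close>

lemma finite_all_edges [simp]: "finite (all_edges n)"
  unfolding all_edges_def by (rule finite_subset[of _ "Pow {..<n}"]) auto

lemma card_all_edges: "card (all_edges n) = n choose 2"
  unfolding all_edges_def using n_subsets[of "{..<n}" 2] by simp

lemma weighted_sum_le_positive_part:
  fixes a c :: "'i \<Rightarrow> real"
  assumes "finite S" "\<And>i. i \<in> S \<Longrightarrow> 0 \<le> a i \<and> a i \<le> 1"
  shows "(\<Sum>i\<in>S. a i * c i) \<le> (\<Sum>i\<in>{i\<in>S. 0 < c i}. c i)"
proof -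
  have "a i * c i \<le> (if 0 < c i then c i else 0)" if "i \<in> S" for i
    using assms(2)[OF that] by (auto simp: mult_left_le_one_le mult_nonneg_nonpos)
  then have "(\<Sum>i\<in>S. a i * c i) \<le> (\<Sum>i\<in>S. if 0 < c i then c i else 0)" by (rule sum_mono)
  also have "\<dots> = (\<Sum>i\<in>{i\<in>S. 0 < c i}. c i)" using assms(1) by (simp add: sum.inter_filter)
  finally show ?thesis .
qed

text \<open>A linear form on a cube is largest at a vertex. With \<open>b\<close> fixed this
  replaces \<open>a\<close> by the indicator of a set \<open>A\<close>; with \<open>A\<close> fixed
  it then replaces \<open>b\<close> by that of \<open>B\<close>.\<close>

lemma bilinear_le_cut:
  fixes a b :: "'i \<Rightarrow> real"
  assumes "finite S" and a: "\<And>i. i \<in> S \<Longrightarrow> 0 \<le> a i \<and> a i \<le> 1" and b: "\<And>i. i \<in> S \<Longrightarrow> 0 \<le> b i \<and> b i \<le> 1"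
    and D: "\<And>A B. A \<subseteq> S \<Longrightarrow> B \<subseteq> S \<Longrightarrow> (\<Sum>i\<in>A. \<Sum>j\<in>B. K i j) \<le> D"
  shows "(\<Sum>i\<in>S. \<Sum>j\<in>S. a i * b j * K i j) \<le> D"
proof -
  define A where "A = {i\<in>S. 0 < (\<Sum>j\<in>S. b j * K i j)}"
  define B where "B = {j\<in>S. 0 < (\<Sum>i\<in>A. K i j)}"
  have "(\<Sum>i\<in>S. \<Sum>j\<in>S. a i * b j * K i j) = (\<Sum>i\<in>S. a i * (\<Sum>j\<in>S. b j * K i j))"
    by (simp add: sum_distrib_left mult.assoc)
  also have "\<dots> \<le> (\<Sum>i\<in>A. \<Sum>j\<in>S. b j * K i j)"
    unfolding A_def using assms(1) a by (rule weighted_sum_le_positive_part)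
  also have "\<dots> = (\<Sum>j\<in>S. b j * (\<Sum>i\<in>A. K i j))"
    by (subst sum.swap) (simp add: sum_distrib_left)
  also have "\<dots> \<le> (\<Sum>j\<in>B. \<Sum>i\<in>A. K i j)"
    unfolding B_def using assms(1) b by (rule weighted_sum_le_positive_part)
  also have "\<dots> = (\<Sum>i\<in>A. \<Sum>j\<in>B. K i j)" by (rule sum.swap)
  also have "\<dots> \<le> D" by (rule D) (auto simp: A_def B_def)
  finally show ?thesis .
qed

lemma abs_bilinear_le_cut:
  fixes a b :: "'i \<Rightarrow> real"
  assumes "finite S" and a: "\<And>i. i \<in> S \<Longrightarrow> 0 \<le> a i \<and> a i \<le> 1" and b: "\<And>i. i \<in> S \<Longrightarrow> 0 \<le> b i \<and> b i \<le> 1"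
    and D: "\<And>A B. A \<subseteq> S \<Longrightarrow> B \<subseteq> S \<Longrightarrow> \<bar>\<Sum>i\<in>A. \<Sum>j\<in>B. K i j\<bar> \<le> D"
  shows "\<bar>\<Sum>i\<in>S. \<Sum>j\<in>S. a i * b j * K i j\<bar> \<le> D"
proof -
  have "(\<Sum>i\<in>S. \<Sum>j\<in>S. a i * b j * K i j) \<le> D"
    by (rule bilinear_le_cut[OF assms(1) a b]) (use D in \<open>auto intro: order_trans[OF abs_ge_self]\<close>)
  moreover have "(\<Sum>i\<in>S. \<Sum>j\<in>S. a i * b j * - K i j) \<le> D"
    by (rule bilinear_le_cut[OF assms(1) a b]) (use D in \<open>auto simp: sum_negf intro: order_trans[OF abs_ge_minus_self]\<close>)
  ultimately show ?thesis by (simp add: sum_negf abs_le_iff)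
qed

lemma sum_PiE_insert:
  assumes "a \<notin> S"
  shows "(\<Sum>\<phi>\<in>insert a S \<rightarrow>\<^sub>E T. F \<phi>) = (\<Sum>\<psi>\<in>S \<rightarrow>\<^sub>E T. \<Sum>i\<in>T. F (\<psi>(a := i)))"
proof -
  have inj: "inj_on (\<lambda>(y, g). g(a := y)) (T \<times> (S \<rightarrow>\<^sub>E T))"
    using inj_combinator[OF assms, of "\<lambda>_. T"] by simp
  have "(\<Sum>\<phi>\<in>insert a S \<rightarrow>\<^sub>E T. F \<phi>) = (\<Sum>(y, g)\<in>T \<times> (S \<rightarrow>\<^sub>E T). F (g(a := y)))"
    unfolding PiE_insert_eq using sum.reindex[OF inj, of F] by (simp add: case_prod_unfold o_def)
  also have "\<dots> = (\<Sum>i\<in>T. \<Sum>\<psi>\<in>S \<rightarrow>\<^sub>E T. F (\<psi>(a := i)))"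
    by (rule sum.cartesian_product[symmetric])
  finally show ?thesis by (subst sum.swap)
qed

lemma edge_update:
  assumes "a \<notin> e"
  shows "(\<psi>(a := i)) ` e = \<psi> ` e"
  using assms by auto

text \<open>Fixing the images of all vertices outside \<^term>\<open>e\<close> turns the sum into a bilinear form.\<close>
lemma edge_sum_le_cut:
  fixes W :: "nat set \<Rightarrow> nat set \<Rightarrow> real" and K :: "nat set \<Rightarrow> real"
  assumes e: "e \<in> all_edges m" and F: "F \<subseteq> all_edges m" "e \<notin> F"
    and W: "\<And>e' u. 0 \<le> W e' u \<and> W e' u \<le> 1"
    and D: "\<And>A B. A \<subseteq> {..<N} \<Longrightarrow> B \<subseteq> {..<N} \<Longrightarrow> \<bar>\<Sum>i\<in>A. \<Sum>j\<in>B. K {i, j}\<bar> \<le> D"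
  shows "\<bar>\<Sum>\<phi>\<in>{..<m} \<rightarrow>\<^sub>E {..<N}. K (\<phi> ` e) * (\<Prod>e'\<in>F. W e' (\<phi> ` e'))\<bar> \<le> real N ^ (m - 2) * D"
proof -
  obtain a b where ab: "e = {a, b}" "a \<noteq> b" "a < m" "b < m"
    using e by (auto simp: all_edges_def card_2_iff)
  define S where "S = {..<m} - {a, b}"
  have fin_F: "finite F" using finite_subset[OF F(1)] by simp
  have m: "{..<m} = insert a (insert b S)" "a \<notin> insert b S" "b \<notin> S" "finite S"
    using ab by (auto simp: S_def)
  have card_S: "card S = m - 2" using ab by (simp add: S_def card_Diff_subset)
  define Fa Fb F0 where "Fa = {e'\<in>F. a \<in> e'}" and "Fb = {e'\<in>F. b \<in> e'}" and "F0 = {e'\<in>F. a \<notin> e' \<and> b \<notin> e'}"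
  \<comment> \<open>Two distinct edges share at most one vertex. So every other factor depends on
    the image of \<open>a\<close>, on the image of \<open>b\<close>, or on neither, which produces
    the bilinear form.\<close>
  have not_both: "\<not> (a \<in> e' \<and> b \<in> e')" if "e' \<in> F" for e'
  proof
    assume "a \<in> e' \<and> b \<in> e'"
    then have sub: "e \<subseteq> e'" by (simp add: ab)
    have "card e' = 2" "card e = 2" using that F(1) e by (auto simp: all_edges_def)
    then have "e = e'" using sub by (metis card_subset_eq card.infinite zero_neq_numeral)
    then show False using that F(2) by simp
  qed
  have F_split: "F = Fa \<union> Fb \<union> F0" "Fa \<inter> Fb = {}" "(Fa \<union> Fb) \<inter> F0 = {}"
    using not_both by (auto simp: Fa_def Fb_def F0_def)
  have fins: "finite Fa" "finite Fb" "finite F0"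
    using fin_F by (auto simp: Fa_def Fb_def F0_def)
  have prod01: "0 \<le> (\<Prod>e'\<in>F'. W e' (h e')) \<and> (\<Prod>e'\<in>F'. W e' (h e')) \<le> 1" for F' h
    using W by (auto intro!: prod_nonneg prod_le_1)
  define \<alpha> \<beta> \<gamma> where "\<alpha> \<psi> i = (\<Prod>e'\<in>Fa. W e' ((\<psi>(a := i)) ` e'))"
    and "\<beta> \<psi> j = (\<Prod>e'\<in>Fb. W e' ((\<psi>(b := j)) ` e'))"
    and "\<gamma> \<psi> = (\<Prod>e'\<in>F0. W e' (\<psi> ` e'))" for \<psi> :: "nat \<Rightarrow> nat" and i j :: nat
  have split: "K ((\<psi>(b := j, a := i)) ` e) * (\<Prod>e'\<in>F. W e' ((\<psi>(b := j, a := i)) ` e'))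
      = \<gamma> \<psi> * (\<alpha> \<psi> i * \<beta> \<psi> j * K {i, j})" for \<psi> i j
  proof -
    have "(\<psi>(b := j, a := i)) ` e = {i, j}" using ab by auto
    moreover have "(\<Prod>e'\<in>Fa. W e' ((\<psi>(b := j, a := i)) ` e')) = \<alpha> \<psi> i"
    proof -
      have "(\<psi>(b := j, a := i)) ` e' = (\<psi>(a := i)) ` e'" if "e' \<in> Fa" for e'
      proof -
        have "b \<notin> e'" using that not_both by (auto simp: Fa_def)
        then show ?thesis using ab(2) by (metis edge_update fun_upd_twist)
      qed
      then show ?thesis unfolding \<alpha>_def by (intro prod.cong) auto
    qed
    moreover have "(\<Prod>e'\<in>Fb. W e' ((\<psi>(b := j, a := i)) ` e')) = \<beta> \<psi> j"
      unfolding \<beta>_def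
    proof (rule prod.cong[OF refl])
      fix e' assume "e' \<in> Fb"
      then have "a \<notin> e'" using not_both by (auto simp: Fb_def)
      show "W e' ((\<psi>(b := j, a := i)) ` e') = W e' ((\<psi>(b := j)) ` e')"
        by (rule arg_cong[OF edge_update[OF \<open>a \<notin> e'\<close>]])
    qed
    moreover have "(\<Prod>e'\<in>F0. W e' ((\<psi>(b := j, a := i)) ` e')) = \<gamma> \<psi>"
      unfolding \<gamma>_def by (intro prod.cong refl) (auto simp: F0_def edge_update simp del: fun_upd_apply)
    moreover have "(\<Prod>e'\<in>F. W e' ((\<psi>(b := j, a := i)) ` e')) = (\<Prod>e'\<in>Fa. W e' ((\<psi>(b := j, a := i)) ` e'))
        * (\<Prod>e'\<in>Fb. W e' ((\<psi>(b := j, a := i)) ` e')) * (\<Prod>e'\<in>F0. W e' ((\<psi>(b := j, a := i)) ` e'))"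
      using fins F_split(2,3) unfolding F_split(1) by (simp add: prod.union_disjoint)
    ultimately show ?thesis by (simp only: mult_ac)
  qed
  have "(\<Sum>\<phi>\<in>{..<m} \<rightarrow>\<^sub>E {..<N}. K (\<phi> ` e) * (\<Prod>e'\<in>F. W e' (\<phi> ` e')))
      = (\<Sum>\<psi>\<in>S \<rightarrow>\<^sub>E {..<N}. \<Sum>j<N. \<Sum>i<N. \<gamma> \<psi> * (\<alpha> \<psi> i * \<beta> \<psi> j * K {i, j}))"
    unfolding m(1) sum_PiE_insert[OF m(2)] sum_PiE_insert[OF m(3)] split ..
  also have "\<dots> = (\<Sum>\<psi>\<in>S \<rightarrow>\<^sub>E {..<N}. \<gamma> \<psi> * (\<Sum>i<N. \<Sum>j<N. \<alpha> \<psi> i * \<beta> \<psi> j * K {i, j}))"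
    unfolding sum_distrib_left by (rule sum.cong[OF refl], rule sum.swap)
  finally have eq: "(\<Sum>\<phi>\<in>{..<m} \<rightarrow>\<^sub>E {..<N}. K (\<phi> ` e) * (\<Prod>e'\<in>F. W e' (\<phi> ` e')))
      = (\<Sum>\<psi>\<in>S \<rightarrow>\<^sub>E {..<N}. \<gamma> \<psi> * (\<Sum>i<N. \<Sum>j<N. \<alpha> \<psi> i * \<beta> \<psi> j * K {i, j}))" .
  have "\<bar>\<Sum>\<psi>\<in>S \<rightarrow>\<^sub>E {..<N}. \<gamma> \<psi> * (\<Sum>i<N. \<Sum>j<N. \<alpha> \<psi> i * \<beta> \<psi> j * K {i, j})\<bar>
      \<le> (\<Sum>\<psi>\<in>S \<rightarrow>\<^sub>E {..<N}. \<bar>\<gamma> \<psi> * (\<Sum>i<N. \<Sum>j<N. \<alpha> \<psi> i * \<beta> \<psi> j * K {i, j})\<bar>)"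
    by (rule sum_abs)
  also have "\<dots> \<le> (\<Sum>\<psi>\<in>S \<rightarrow>\<^sub>E {..<N}. D)"
  proof (rule sum_mono)
    fix \<psi> assume "\<psi> \<in> S \<rightarrow>\<^sub>E {..<N}"
    have a01: "0 \<le> \<alpha> \<psi> i \<and> \<alpha> \<psi> i \<le> 1" for i
      unfolding \<alpha>_def by (rule prod01)
    have b01: "0 \<le> \<beta> \<psi> i \<and> \<beta> \<psi> i \<le> 1" for i
      unfolding \<beta>_def by (rule prod01)
    have *: "\<bar>\<Sum>i<N. \<Sum>j<N. \<alpha> \<psi> i * \<beta> \<psi> j * K {i, j}\<bar> \<le> D"
      by (rule abs_bilinear_le_cut[OF finite_lessThan a01 b01 D])
    have "0 \<le> \<gamma> \<psi>" "\<gamma> \<psi> \<le> 1" unfolding \<gamma>_def using prod01[where F' = F0 and h = "(`) \<psi>"] by simp_all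
    then have "\<bar>\<gamma> \<psi> * (\<Sum>i<N. \<Sum>j<N. \<alpha> \<psi> i * \<beta> \<psi> j * K {i, j})\<bar> \<le> 1 * D"
      unfolding abs_mult using * by (intro mult_mono) auto
    then show "\<bar>\<gamma> \<psi> * (\<Sum>i<N. \<Sum>j<N. \<alpha> \<psi> i * \<beta> \<psi> j * K {i, j})\<bar> \<le> D" by simp
  qed
  also have "\<dots> = real N ^ (m - 2) * D"
    using m(4) by (simp add: card_PiE card_S)
  finally show ?thesis unfolding eq .
qed

text \<open>Edges in \<open>F\<close> still carry \<open>x\<close>, those in \<open>R\<close> have
  been switched to \<open>p\<close>; each switch costs one cut bound. The induction moves edges from
  \<open>F\<close> to \<open>R\<close>, so \<open>R\<close> has to be arbitrary.\<close>

lemma counting_telescope: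
  fixes x p :: "nat set \<Rightarrow> real"
  assumes "finite F" "F \<subseteq> all_edges m" "R \<subseteq> all_edges m" "F \<inter> R = {}"
    and x: "\<And>u. 0 \<le> x u \<and> x u \<le> 1" and p: "\<And>u. 0 \<le> p u \<and> p u \<le> 1"
    and D: "\<And>A B. A \<subseteq> {..<N} \<Longrightarrow> B \<subseteq> {..<N} \<Longrightarrow> \<bar>\<Sum>i\<in>A. \<Sum>j\<in>B. x {i, j} - p {i, j}\<bar> \<le> D"
  shows "\<bar>(\<Sum>\<phi>\<in>{..<m} \<rightarrow>\<^sub>E {..<N}. (\<Prod>e\<in>F. x (\<phi> ` e)) * (\<Prod>e\<in>R. p (\<phi> ` e)))
     - (\<Sum>\<phi>\<in>{..<m} \<rightarrow>\<^sub>E {..<N}. \<Prod>e\<in>F \<union> R. p (\<phi> ` e))\<bar> \<le> real (card F) * (real N ^ (m - 2) * D)"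
  using assms(1-4)
proof (induction F arbitrary: R rule: finite_induct)
  case empty
  then show ?case by simp
next
  case (insert e F)
  have fin_R: "finite R" using finite_subset[OF insert.prems(2)] by simp
  let ?\<Phi> = "{..<m} \<rightarrow>\<^sub>E {..<N}"
  define W where "W e' = (if e' \<in> F then x else p)" for e'
  have eR: "e \<notin> R" "F \<inter> R = {}" using insert.prems by auto
  have "(\<Prod>e'\<in>F \<union> R. W e' (\<phi> ` e')) = (\<Prod>e\<in>F. x (\<phi> ` e)) * (\<Prod>e\<in>R. p (\<phi> ` e))" for \<phi> :: "nat \<Rightarrow> nat"
  proof -
    have "(\<Prod>e'\<in>F. W e' (\<phi> ` e')) = (\<Prod>e\<in>F. x (\<phi> ` e))" by (intro prod.cong) (auto simp: W_def)
    moreover have "(\<Prod>e'\<in>R. W e' (\<phi> ` e')) = (\<Prod>e\<in>R. p (\<phi> ` e))"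
      using eR by (intro prod.cong) (auto simp: W_def)
    ultimately show ?thesis using insert.hyps fin_R eR by (simp add: prod.union_disjoint)
  qed
  then have diff: "(\<Prod>e\<in>insert e F. x (\<phi> ` e)) * (\<Prod>e\<in>R. p (\<phi> ` e)) - (\<Prod>e\<in>F. x (\<phi> ` e)) * (\<Prod>e\<in>insert e R. p (\<phi> ` e))
      = (x (\<phi> ` e) - p (\<phi> ` e)) * (\<Prod>e'\<in>F \<union> R. W e' (\<phi> ` e'))" for \<phi> :: "nat \<Rightarrow> nat"
    using insert.hyps fin_R eR by (simp add: algebra_simps)
  have "\<bar>\<Sum>\<phi>\<in>?\<Phi>. (x (\<phi> ` e) - p (\<phi> ` e)) * (\<Prod>e'\<in>F \<union> R. W e' (\<phi> ` e'))\<bar> \<le> real N ^ (m - 2) * D"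
    by (rule edge_sum_le_cut[where K = "\<lambda>u. x u - p u"])
       (use insert.prems insert.hyps eR x p D in \<open>auto simp: W_def\<close>)
  then have 1: "\<bar>(\<Sum>\<phi>\<in>?\<Phi>. (\<Prod>e\<in>insert e F. x (\<phi> ` e)) * (\<Prod>e\<in>R. p (\<phi> ` e)))
      - (\<Sum>\<phi>\<in>?\<Phi>. (\<Prod>e\<in>F. x (\<phi> ` e)) * (\<Prod>e\<in>insert e R. p (\<phi> ` e)))\<bar> \<le> real N ^ (m - 2) * D"
    unfolding sum_subtractf[symmetric] diff .
  have 2: "\<bar>(\<Sum>\<phi>\<in>?\<Phi>. (\<Prod>e\<in>F. x (\<phi> ` e)) * (\<Prod>e\<in>insert e R. p (\<phi> ` e)))
     - (\<Sum>\<phi>\<in>?\<Phi>. \<Prod>e\<in>F \<union> insert e R. p (\<phi> ` e))\<bar> \<le> real (card F) * (real N ^ (m - 2) * D)"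
    by (rule insert.IH) (use insert.prems insert.hyps in auto)
  have "F \<union> insert e R = insert e F \<union> R" by auto
  then show ?case using 1 2 insert.hyps by (simp add: algebra_simps)
qed

section \<open>Expected homomorphism densities under product measures\<close>

lemma prob_superset_indep_set:
  assumes "finite E" "\<And>u. u \<in> E \<Longrightarrow> 0 \<le> p u \<and> p u \<le> 1" "finite S"
  shows "measure_pmf.prob (indep_set E p) {G. S \<subseteq> G} = (\<Prod>u\<in>S. if u \<in> E then p u else 0)"
proof (cases "S \<subseteq> E")
  case True
  have "{f. S \<subseteq> Collect f} = Pi E (\<lambda>u. if u \<in> S then {True} else UNIV)"
    using True by (auto simp: Pi_def split: if_splits)
  then have "measure_pmf.prob (indep_set E p) {G. S \<subseteq> G}
      = (\<Prod>u\<in>E. measure_pmf.prob (bernoulli_pmf (p u)) (if u \<in> S then {True} else UNIV))"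
    using assms(1) by (simp add: indep_set_def vimage_def measure_Pi_pmf_Pi)
  also have "\<dots> = (\<Prod>u\<in>E. if u \<in> S then p u else 1)"
    using assms(2) by (intro prod.cong) (auto simp: measure_pmf_single)
  also have "\<dots> = (\<Prod>u\<in>S. if u \<in> S then p u else 1)"
    using True assms(1) by (intro prod.mono_neutral_right) auto
  also have "\<dots> = (\<Prod>u\<in>S. if u \<in> E then p u else 0)"
    using True by (intro prod.cong) auto
  finally show ?thesis .
next
  case False
  then obtain u where "u \<in> S" "u \<notin> E" by auto
  then have "(\<Prod>u\<in>S. if u \<in> E then p u else 0) = 0" using assms(3) by (intro prod_zero) auto
  moreover have "measure_pmf.prob (indep_set E p) {G. S \<subseteq> G} = 0"
    using False set_indep_set[OF assms(1), of p] by (auto simp: measure_pmf_zero_iff)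
  ultimately show ?thesis by simp
qed

lemma all_edges_two_le:
  assumes "e \<in> all_edges m"
  shows "2 \<le> m"
  using assms card_mono[of "{..<m}" e] by (auto simp: all_edges_def)

lemma hom_count_eq_sum:
  "real (hom_count (m, F) N g) = (\<Sum>\<phi>\<in>{..<m} \<rightarrow>\<^sub>E {..<N}. of_bool (\<forall>e\<in>F. \<phi> ` e \<in> g))"
  unfolding hom_count_def by (simp add: sum_of_bool_eq finite_PiE Int_def)

lemma of_bool_ball_eq_prod:
  "finite F \<Longrightarrow> (of_bool (\<forall>e\<in>F. P e) :: real) = (\<Prod>e\<in>F. of_bool (P e))"
  by (induction F rule: finite_induct) auto

text \<open>Edges with a common image give a single factor on the right but repeated factors from
  the unit interval on the left.\<close>

lemma prod_image_ge:
  fixes p :: "'b \<Rightarrow> real"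
  assumes "finite F" "\<And>u. 0 \<le> p u \<and> p u \<le> 1"
  shows "(\<Prod>e\<in>F. p (h e)) \<le> (\<Prod>u\<in>h ` F. p u)"
  using assms(1)
proof (induction F rule: finite_induct)
  case (insert e F)
  have nn: "0 \<le> (\<Prod>e\<in>F. p (h e))" using assms(2) by (intro prod_nonneg) auto
  show ?case
  proof (cases "h e \<in> h ` F")
    case True
    have "p (h e) * (\<Prod>e\<in>F. p (h e)) \<le> 1 * (\<Prod>e\<in>F. p (h e))"
      using assms(2) nn by (intro mult_right_mono) auto
    then show ?thesis using insert True by (simp add: insert_absorb)
  next
    case False
    then show ?thesis using insert assms(2) by (simp add: mult_left_mono)
  qed
qed simp

text \<open>If two edges have the same image, then two of the at most \<open>2 * card F\<close>
  endpoints collide, and each collision removes one free choice. Counting endpoints rather than all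
  \<open>m\<close> vertices makes the constant depend on edges only.\<close>

lemma card_non_injective_le:
  assumes F: "F \<subseteq> all_edges m" and N: "0 < N"
  shows "real (card {\<phi> \<in> {..<m} \<rightarrow>\<^sub>E {..<N}. \<not> inj_on ((`) \<phi>) F}) \<le> 4 * real (card F)^2 * real N ^ (m - 1)"
proof -
  have fin_F: "finite F" using finite_subset[OF F] by simp
  let ?\<Phi> = "{..<m} \<rightarrow>\<^sub>E {..<N}"
  define V where "V = \<Union>F"
  have V_sub: "V \<subseteq> {..<m}" using F by (auto simp: V_def all_edges_def)
  have fin_V: "finite V" using finite_subset[OF V_sub] by simp
  have "card V \<le> (\<Sum>e\<in>F. card e)"
    unfolding V_def by (rule card_Union_le_sum_card)
  also have "\<dots> = (\<Sum>e\<in>F. 2)" using F by (intro sum.cong) (auto simp: all_edges_def)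
  finally have card_V: "card V \<le> 2 * card F" by simp
  define C where "C z = {\<phi> \<in> ?\<Phi>. \<phi> (fst z) = \<phi> (snd z)}" for z
  have fin_C: "finite (C z)" for z by (auto simp: C_def intro!: finite_PiE)
  have card_C: "card (C z) \<le> N ^ (m - 1)" if z: "z \<in> V \<times> V" "fst z \<noteq> snd z" for z
  proof -
    obtain c d where cd: "z = (c, d)" "c < m" "d < m" "c \<noteq> d" using z V_sub by (cases z) auto
    have "card (C z) \<le> card (({..<m} - {c}) \<rightarrow>\<^sub>E {..<N})"
    \<comment> \<open>A map in \<open>C z\<close> is determined by its values off \<open>c\<close>,
      since it agrees at \<open>c\<close> and \<open>d\<close>.\<close>
    proof (rule card_inj_on_le[where f = "\<lambda>\<phi>. \<phi>(c := undefined)"])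
      show "inj_on (\<lambda>\<phi>. \<phi>(c := undefined)) (C z)"
      proof (rule inj_onI)
        fix \<phi> \<psi> assume h: "\<phi> \<in> C z" "\<psi> \<in> C z" "\<phi>(c := undefined) = \<psi>(c := undefined)"
        have off: "\<phi> i = \<psi> i" if "i \<noteq> c" for i using fun_cong[OF h(3), of i] that by simp
        have "\<phi> c = \<phi> d" "\<psi> c = \<psi> d" using h(1,2) by (auto simp: C_def cd)
        then have "\<phi> c = \<psi> c" using off[of d] cd by simp
        with off show "\<phi> = \<psi>" by (metis ext)
      qed
      show "(\<lambda>\<phi>. \<phi>(c := undefined)) ` C z \<subseteq> ({..<m} - {c}) \<rightarrow>\<^sub>E {..<N}"
        by (auto simp: C_def PiE_iff extensional_def split: if_splits)
    qed (auto intro!: finite_PiE)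
    also have "\<dots> = N ^ (m - 1)" using cd by (simp add: card_PiE card_Diff_subset)
    finally show ?thesis .
  qed
  define I where "I = {z \<in> V \<times> V. fst z \<noteq> snd z}"
  have fin_I: "finite I" using fin_V by (auto simp: I_def)
  have "{\<phi> \<in> ?\<Phi>. \<not> inj_on ((`) \<phi>) F} \<subseteq> (\<Union>z\<in>I. C z)"
  proof
    fix \<phi> assume h: "\<phi> \<in> {\<phi> \<in> ?\<Phi>. \<not> inj_on ((`) \<phi>) F}"
    then have "\<not> inj_on \<phi> V" unfolding V_def using inj_on_image by blast
    then obtain c d where "c \<in> V" "d \<in> V" "c \<noteq> d" "\<phi> c = \<phi> d" by (auto simp: inj_on_def)
    then show "\<phi> \<in> (\<Union>z\<in>I. C z)" using h by (intro UN_I[of "(c, d)"]) (auto simp: I_def C_def)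
  qed
  then have "card {\<phi> \<in> ?\<Phi>. \<not> inj_on ((`) \<phi>) F} \<le> card (\<Union>z\<in>I. C z)"
    using fin_I fin_C by (intro card_mono) auto
  also have "\<dots> \<le> (\<Sum>z\<in>I. card (C z))" using fin_I by (rule card_UN_le)
  also have "\<dots> \<le> (\<Sum>z\<in>I. N ^ (m - 1))" using card_C by (intro sum_mono) (auto simp: I_def)
  also have "\<dots> = card I * N ^ (m - 1)" by simp
  also have "\<dots> \<le> card (V \<times> V) * N ^ (m - 1)"
    using fin_V by (intro mult_right_mono card_mono) (auto simp: I_def)
  also have "\<dots> \<le> (2 * card F) * (2 * card F) * N ^ (m - 1)"
    unfolding card_cartesian_product using card_V by (intro mult_right_mono mult_mono) auto
  finally have "real (card {\<phi> \<in> ?\<Phi>. \<not> inj_on ((`) \<phi>) F}) \<le> real ((2 * card F) * (2 * card F) * N ^ (m - 1))"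
    by (simp only: of_nat_le_iff)
  then show ?thesis by (simp add: power2_eq_square)
qed

text \<open>The weighted count and the expected count differ only in the maps identifying two of the
  \<open>k\<close> edges of the pattern. These number at most \<open>N\<^sup>m\<close> and at most \<open>4 k\<^sup>2 N\<^bsup>m-1\<^esup>\<close>; the
  geometric mean of the two bounds is linear in \<open>k\<close>.\<close>
lemma hom_density_mean_field:
  fixes p :: "nat set \<Rightarrow> real" and N m :: nat and b D :: real
  defines "p' \<equiv> \<lambda>u. if u \<in> all_edges N then p u else 0"
    and "q \<equiv> indep_set (all_edges N) p"
  assumes p: "\<And>u. u \<in> all_edges N \<Longrightarrow> 0 \<le> p u \<and> p u \<le> 1"
    and F: "F \<subseteq> all_edges m" and N: "0 < N" and g: "g \<subseteq> all_edges N"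
    and D: "\<And>A B. A \<subseteq> {..<N} \<Longrightarrow> B \<subseteq> {..<N} \<Longrightarrow> \<bar>\<Sum>i\<in>A. \<Sum>j\<in>B. of_bool ({i, j} \<in> g) - p' {i, j}\<bar> \<le> D"
  shows "real N ^ 2 * (b * (hom_density (m, F) N g - (\<Sum>G\<in>graphs N. pmf q G * hom_density (m, F) N G)))
    \<le> \<bar>b\<bar> * real (card F) * (D + 2 * real N * sqrt (real N))"
proof -
  let ?\<Phi> = "{..<m} \<rightarrow>\<^sub>E {..<N}" and ?k = "real (card F)"
  have fin_F: "finite F" using finite_subset[OF F] by simp
  \<comment> \<open>\<open>p'\<close> vanishes at singletons, to which a map may collapse an
    edge.\<close>
  have p': "0 \<le> p' u \<and> p' u \<le> 1" for u using p by (auto simp: p'_def)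
  define t where "t = hom_density (m, F) N g"
  \<comment> \<open>Between the density \<open>t\<close> of \<open>g\<close> and the expected
    density \<open>r\<close> stands the weighted density \<open>s\<close>, where coinciding edge
    images count with multiplicity.\<close>
  define s where "s = (\<Sum>\<phi>\<in>?\<Phi>. \<Prod>e\<in>F. p' (\<phi> ` e)) / real N ^ m"
  define r where "r = (\<Sum>G\<in>graphs N. pmf q G * hom_density (m, F) N G)"
  have fin_\<Phi>: "finite ?\<Phi>" by (auto intro!: finite_PiE)
  have card_\<Phi>: "real (card ?\<Phi>) = real N ^ m" by (simp add: card_PiE)
  have D0: "0 \<le> D" using D[of "{}" "{}"] by simp
  \<comment> \<open>An edge forces \<open>2 \<le> m\<close>, so \<open>m - 2\<close> is not
    truncated; without edges \<open>t\<close> and \<open>s\<close> are both 1.\<close>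
  have close: "real N ^ 2 * \<bar>t - s\<bar> \<le> ?k * D"
  proof (cases "F = {}")
    case True
    then show ?thesis using card_\<Phi> N fin_\<Phi> by (simp add: t_def s_def hom_density_def hom_count_eq_sum)
  next
    case False
    then obtain e where "e \<in> all_edges m" using F by auto
    then have m: "2 \<le> m" by (rule all_edges_two_le)
    have "\<bar>(\<Sum>\<phi>\<in>?\<Phi>. (\<Prod>e\<in>F. of_bool (\<phi> ` e \<in> g)) * (\<Prod>e\<in>{}. p' (\<phi> ` e)))
     - (\<Sum>\<phi>\<in>?\<Phi>. \<Prod>e\<in>F \<union> {}. p' (\<phi> ` e))\<bar> \<le> ?k * (real N ^ (m - 2) * D)"
      by (rule counting_telescope) (use fin_F F p' D in auto)
    then have "\<bar>real (hom_count (m, F) N g) - s * real N ^ m\<bar> \<le> ?k * (real N ^ (m - 2) * D)"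
      using N by (simp add: hom_count_eq_sum of_bool_ball_eq_prod[OF fin_F] s_def)
    moreover have "real (hom_count (m, F) N g) = t * real N ^ m"
      using N by (simp add: t_def hom_density_def)
    ultimately have "\<bar>t - s\<bar> * real N ^ m \<le> ?k * (real N ^ (m - 2) * D)"
      by (simp add: abs_mult flip: left_diff_distrib)
    also have "real N ^ m = real N ^ 2 * real N ^ (m - 2)"
      by (metis power_add le_add_diff_inverse m)
    finally have "(real N ^ 2 * \<bar>t - s\<bar>) * real N ^ (m - 2) \<le> (?k * D) * real N ^ (m - 2)"
      by (simp add: mult_ac)
    then show ?thesis using N by (simp add: mult_le_cancel_right)
  qed
  have r: "r * real N ^ m = (\<Sum>\<phi>\<in>?\<Phi>. \<Prod>u\<in>((`) \<phi>) ` F. p' u)"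
  proof -
    have "r * real N ^ m = (\<Sum>G\<in>graphs N. pmf q G * real (hom_count (m, F) N G))"
      using N by (simp add: r_def hom_density_def sum_distrib_right)
    also have "\<dots> = (\<Sum>\<phi>\<in>?\<Phi>. \<Sum>G\<in>graphs N. pmf q G * of_bool (\<forall>e\<in>F. \<phi> ` e \<in> G))"
      unfolding hom_count_eq_sum sum_distrib_left by (rule sum.swap)
    also have "\<dots> = (\<Sum>\<phi>\<in>?\<Phi>. \<Prod>u\<in>((`) \<phi>) ` F. p' u)"
    proof (rule sum.cong[OF refl])
      fix \<phi> assume "\<phi> \<in> ?\<Phi>"
      have "(\<Sum>G\<in>graphs N. pmf q G * of_bool (\<forall>e\<in>F. \<phi> ` e \<in> G)) = measure_pmf.prob q {G. \<forall>e\<in>F. \<phi> ` e \<in> G}"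
        by (rule sum_pmf_of_bool) (use set_indep_set[of "all_edges N" p] in \<open>auto simp: graphs_def q_def\<close>)
      also have "{G. \<forall>e\<in>F. \<phi> ` e \<in> G} = {G. ((`) \<phi>) ` F \<subseteq> G}" by auto
      also have "measure_pmf.prob q {G. ((`) \<phi>) ` F \<subseteq> G} = (\<Prod>u\<in>((`) \<phi>) ` F. p' u)"
        unfolding q_def p'_def by (rule prob_superset_indep_set) (use p fin_F in auto)
      finally show "(\<Sum>G\<in>graphs N. pmf q G * of_bool (\<forall>e\<in>F. \<phi> ` e \<in> G)) = (\<Prod>u\<in>((`) \<phi>) ` F. p' u)" .
    qed
    finally show ?thesis .
  qed
  have s: "s * real N ^ m = (\<Sum>\<phi>\<in>?\<Phi>. \<Prod>e\<in>F. p' (\<phi> ` e))" using N by (simp add: s_def)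
  have s_le_r: "s \<le> r"
  proof -
    have "s * real N ^ m \<le> r * real N ^ m"
      unfolding s r by (intro sum_mono prod_image_ge fin_F p')
    then show ?thesis using N by (simp add: mult_le_cancel_right)
  qed
  have gap: "(r - s) * real N ^ m \<le> real (card {\<phi> \<in> ?\<Phi>. \<not> inj_on ((`) \<phi>) F})"
  proof -
    have "(r - s) * real N ^ m = (\<Sum>\<phi>\<in>?\<Phi>. (\<Prod>u\<in>((`) \<phi>) ` F. p' u) - (\<Prod>e\<in>F. p' (\<phi> ` e)))"
      by (simp add: left_diff_distrib r s sum_subtractf)
    also have "\<dots> \<le> (\<Sum>\<phi>\<in>?\<Phi>. of_bool (\<not> inj_on ((`) \<phi>) F))"
    proof (rule sum_mono)
      fix \<phi> assume "\<phi> \<in> ?\<Phi>"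
      show "(\<Prod>u\<in>((`) \<phi>) ` F. p' u) - (\<Prod>e\<in>F. p' (\<phi> ` e)) \<le> of_bool (\<not> inj_on ((`) \<phi>) F)"
      proof (cases "inj_on ((`) \<phi>) F")
        case True
        then show ?thesis by (simp add: prod.reindex)
      next
        case False
        have "(\<Prod>u\<in>((`) \<phi>) ` F. p' u) \<le> 1" "0 \<le> (\<Prod>e\<in>F. p' (\<phi> ` e))"
          using p' by (auto intro!: prod_le_1 prod_nonneg)
        then show ?thesis using False by simp
      qed
    qed
    also have "\<dots> = real (card {\<phi> \<in> ?\<Phi>. \<not> inj_on ((`) \<phi>) F})"
      using fin_\<Phi> by (simp add: sum_of_bool_eq Int_def)
    finally show ?thesis .
  qed
  have degenerate: "real N ^ 2 * (r - s) \<le> 2 * ?k * real N * sqrt (real N)"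
  proof (cases "F = {}")
    case True
    then have "(r - s) * real N ^ m \<le> 0" using gap by simp
    moreover have "0 < real N ^ m" using N by simp
    ultimately have "r - s \<le> 0" by (metis mult_le_0_iff not_le)
    then show ?thesis using True by (simp add: mult_nonneg_nonpos)
  next
    case False
    then obtain e where "e \<in> all_edges m" using F by auto
    then have m: "1 \<le> m" using all_edges_two_le by fastforce
    define y where "y = real N ^ 2 * (r - s)"
    have y0: "0 \<le> y" using s_le_r by (simp add: y_def)
    have "card {\<phi> \<in> ?\<Phi>. \<not> inj_on ((`) \<phi>) F} \<le> card ?\<Phi>"
      using fin_\<Phi> by (intro card_mono) auto
    then have "(r - s) * real N ^ m \<le> real (card ?\<Phi>)"
      using gap by linarith
    then have "r - s \<le> 1" using N by (simp add: card_\<Phi>)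
    then have y1: "y \<le> real N ^ 2" unfolding y_def by (intro mult_left_le) auto
    have "(r - s) * real N ^ m \<le> 4 * ?k ^ 2 * real N ^ (m - 1)"
      using gap card_non_injective_le[OF F N] by linarith
    also have "real N ^ m = real N * real N ^ (m - 1)" using m by (cases m) auto
    finally have "((r - s) * real N) * real N ^ (m - 1) \<le> (4 * ?k ^ 2) * real N ^ (m - 1)"
      by (simp add: mult_ac)
    then have "(r - s) * real N \<le> 4 * ?k ^ 2" using N by (simp add: mult_le_cancel_right)
    then have "real N * ((r - s) * real N) \<le> real N * (4 * ?k ^ 2)" by (intro mult_left_mono) auto
    then have y2: "y \<le> 4 * ?k ^ 2 * real N" by (simp add: y_def power2_eq_square mult_ac)
    have "y\<^sup>2 \<le> real N ^ 2 * (4 * ?k ^ 2 * real N)"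
      unfolding power2_eq_square[of y] using y0 y1 y2 by (intro mult_mono) auto
    also have "\<dots> = (2 * ?k * real N * sqrt (real N))\<^sup>2"
      by (simp only: power_mult_distrib real_sqrt_pow2 of_nat_0_le_iff) simp
    finally have "y \<le> 2 * ?k * real N * sqrt (real N)"
      by (rule power2_le_imp_le) simp
    then show ?thesis unfolding y_def .
  qed
  \<comment> \<open>Since \<open>s \<le> r\<close>, the collision error has the favourable sign for
    \<open>b \<ge> 0\<close> and costs something only for negative \<open>b\<close>.\<close>
  show ?thesis
  proof (cases "0 \<le> b")
    case True
    have "real N ^ 2 * (b * (t - r)) = b * (real N ^ 2 * (t - s) - real N ^ 2 * (r - s))"
      by (simp add: algebra_simps)
    also have "\<dots> \<le> b * (?k * D)"
    proof (rule mult_left_mono[OF _ True])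
      have "real N ^ 2 * (t - s) \<le> real N ^ 2 * \<bar>t - s\<bar>" by (intro mult_left_mono) auto
      moreover have "0 \<le> real N ^ 2 * (r - s)" using s_le_r by simp
      ultimately show "real N ^ 2 * (t - s) - real N ^ 2 * (r - s) \<le> ?k * D" using close by linarith
    qed
    also have "\<dots> \<le> b * (?k * (D + 2 * real N * sqrt (real N)))"
      using True by (intro mult_left_mono) auto
    finally show ?thesis using True by (simp add: t_def r_def mult.assoc)
  next
    case False
    have "real N ^ 2 * (b * (t - r)) = - b * (real N ^ 2 * (s - t) + real N ^ 2 * (r - s))"
      by (simp add: algebra_simps)
    also have "\<dots> \<le> - b * (?k * D + 2 * ?k * real N * sqrt (real N))"
    proof (intro mult_left_mono add_mono degenerate)
      have "real N ^ 2 * (s - t) \<le> real N ^ 2 * \<bar>t - s\<bar>" by (intro mult_left_mono) auto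
      then show "real N ^ 2 * (s - t) \<le> ?k * D" using close by linarith
    qed (use False in auto)
    finally show ?thesis using False by (simp add: t_def r_def algebra_simps)
  qed
qed

section \<open>Exponential random graphs\<close>

text \<open>The sign recovers the absolute value of a cut sum. Recording one direction costs entropy
  \<open>(2 * N + 1) * ln 2\<close>, of the order of the square root of the number of edges.\<close>

definition cut_directions :: "nat \<Rightarrow> (nat set \<times> nat set \<times> real) set" where
  "cut_directions N = Pow {..<N} \<times> Pow {..<N} \<times> {1, -1}"

text \<open>Pairing with this vector gives the signed double sum over \<open>A \<times> B\<close>;
  an edge may occur in both orientations, whence the bound 2.\<close>

definition cut_vector :: "nat set \<times> nat set \<times> real \<Rightarrow> nat set \<Rightarrow> real" where
  "cut_vector = (\<lambda>(A, B, s) u. s * real (card {z \<in> A \<times> B. {fst z, snd z} = u}))"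

lemma finite_cut_directions: "finite (cut_directions N)"
  and cut_directions_nonempty: "cut_directions N \<noteq> {}"
  by (auto simp: cut_directions_def)

lemma card_cut_directions: "card (cut_directions N) = 2 ^ (2 * N + 1)"
  by (simp add: cut_directions_def card_cartesian_product card_Pow mult_2 power_add distrib_left)

lemma cut_vector_bound:
  assumes "j \<in> cut_directions N" "u \<in> all_edges N"
  shows "\<bar>cut_vector j u\<bar> \<le> 2"
proof -
  obtain A B s where j: "j = (A, B, s)" "s = 1 \<or> s = -1" using assms(1) by (auto simp: cut_directions_def)
  obtain k l where u: "u = {k, l}" using assms(2) by (auto simp: all_edges_def card_2_iff)
  have "{z \<in> A \<times> B. {fst z, snd z} = u} \<subseteq> {(k, l), (l, k)}"
    unfolding u by (auto simp: doubleton_eq_iff)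
  then have "card {z \<in> A \<times> B. {fst z, snd z} = u} \<le> card {(k, l), (l, k)}"
    by (rule card_mono[rotated]) simp
  also have "\<dots> \<le> 2" using card_length[of "[(k, l), (l, k)]"] by simp
  finally have "real (card {z \<in> A \<times> B. {fst z, snd z} = u}) \<le> 2" by linarith
  moreover have "\<bar>s\<bar> = 1" using j(2) by auto
  ultimately show ?thesis unfolding cut_vector_def j(1) by (simp add: abs_mult)
qed

lemma cut_sum_eq:
  fixes K :: "nat set \<Rightarrow> real"
  assumes "finite A" "finite B" "finite E" "\<And>u. u \<notin> E \<Longrightarrow> K u = 0"
  shows "(\<Sum>i\<in>A. \<Sum>j\<in>B. K {i, j}) = (\<Sum>u\<in>E. K u * real (card {z \<in> A \<times> B. {fst z, snd z} = u}))"
proof -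
  have "(\<Sum>i\<in>A. \<Sum>j\<in>B. K {i, j}) = (\<Sum>z\<in>A \<times> B. K {fst z, snd z})"
    by (simp add: sum.cartesian_product case_prod_unfold)
  also have "\<dots> = (\<Sum>z\<in>A \<times> B. \<Sum>u\<in>E. if {fst z, snd z} = u then K u else 0)"
    using assms(3,4) by (intro sum.cong) (auto simp: sum.delta)
  also have "\<dots> = (\<Sum>u\<in>E. \<Sum>z\<in>A \<times> B. if {fst z, snd z} = u then K u else 0)"
    by (rule sum.swap)
  also have "\<dots> = (\<Sum>u\<in>E. K u * real (card {z \<in> A \<times> B. {fst z, snd z} = u}))"
    using assms(1,2) by (intro sum.cong refl) (simp add: sum.inter_filter[symmetric])
  finally show ?thesis .
qed

text \<open>Diagonal pairs drop out because both terms vanish at singletons, so the double sum is a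
  pairing with a cut vector.\<close>

lemma cut_le_max_corr:
  fixes Y :: "nat set set \<Rightarrow> 'y" and w :: "nat set set \<Rightarrow> real" and \<Omega> :: "nat set set set"
  defines "p \<equiv> \<lambda>X u. cond_mean w \<Omega> Y (\<lambda>X. of_bool (u \<in> X)) (Y X)"
  assumes "A \<subseteq> {..<N}" "B \<subseteq> {..<N}" "X \<subseteq> all_edges N"
  shows "\<bar>\<Sum>i\<in>A. \<Sum>j\<in>B. of_bool ({i, j} \<in> X) - (if {i, j} \<in> all_edges N then p X {i, j} else 0)\<bar>
    \<le> max_corr w \<Omega> (all_edges N) (\<lambda>X u. of_bool (u \<in> X)) (cut_directions N) cut_vector Y X"
proof -
  let ?K = "\<lambda>u. of_bool (u \<in> X) - (if u \<in> all_edges N then p X u else 0)"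
  let ?D = "max_corr w \<Omega> (all_edges N) (\<lambda>X u. of_bool (u \<in> X)) (cut_directions N) cut_vector Y X"
  have fin: "finite A" "finite B" using assms(2,3) finite_subset[OF _ finite_lessThan] by auto
  have eq: "(\<Sum>i\<in>A. \<Sum>j\<in>B. ?K {i, j}) = (\<Sum>u\<in>all_edges N. ?K u * real (card {z \<in> A \<times> B. {fst z, snd z} = u}))"
    by (rule cut_sum_eq) (use fin assms(4) in auto)
  have le: "s * (\<Sum>i\<in>A. \<Sum>j\<in>B. ?K {i, j}) \<le> ?D" if "s = 1 \<or> s = -1" for s
  proof -
    have "s * (\<Sum>i\<in>A. \<Sum>j\<in>B. ?K {i, j}) = (\<Sum>u\<in>all_edges N. (of_bool (u \<in> X) - p X u) * cut_vector (A, B, s) u)"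
      unfolding eq sum_distrib_left by (intro sum.cong) (auto simp: cut_vector_def)
    also have "\<dots> \<le> ?D"
      unfolding max_corr_def p_def using assms(2,3) that finite_cut_directions
      by (intro Max_ge finite_imageI imageI) (auto simp: cut_directions_def)
    finally show ?thesis .
  qed
  from le[of 1] le[of "-1"] show ?thesis by (simp add: abs_le_iff)
qed

section \<open>The Gibbs law and the mixing measure\<close>

lemma gibbs_pmf_exists:
  fixes f :: "'a set \<Rightarrow> real"
  assumes "finite E"
  obtains M where "\<And>X. pmf M X = (if X \<subseteq> E then exp (f X) / (\<Sum>X\<in>Pow E. exp (f X)) else 0)"
proof -
  let ?Z = "\<Sum>X\<in>Pow E. exp (f X)"
  define h where "h X = (if X \<subseteq> E then exp (f X) / ?Z else 0)" for X
  have Z: "0 < ?Z" using assms by (intro sum_pos) auto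
  have nn: "0 \<le> h X" for X using Z by (simp add: h_def)
  have "(\<integral>\<^sup>+X. ennreal (h X) \<partial>count_space UNIV) = (\<Sum>X\<in>Pow E. ennreal (h X))"
    using assms by (intro nn_integral_count_space') (auto simp: h_def)
  also have "\<dots> = ennreal (\<Sum>X\<in>Pow E. h X)" using nn by (intro sum_ennreal) auto
  also have "(\<Sum>X\<in>Pow E. h X) = 1"
    using Z by (simp add: h_def flip: sum_divide_distrib)
  finally have "pmf (embed_pmf h) X = h X" for X using nn by (intro pmf_embed_pmf) auto
  then show ?thesis by (intro that[of "embed_pmf h"]) (simp add: h_def)
qed

lemma xlnx_eq: "xlnx x = x * ln x"
  by (simp add: xlnx_def)

lemma I_ent_cong: "(\<And>u. u \<in> all_edges N \<Longrightarrow> p u = q u) \<Longrightarrow> I_ent N p = I_ent N q"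
  by (simp add: I_ent_def cong: sum.cong)

lemma indep_graph_prob_cong:
  "(\<And>u. u \<in> all_edges N \<Longrightarrow> p u = q u) \<Longrightarrow> indep_graph_prob N p g = indep_graph_prob N q g"
  unfolding indep_graph_prob_def by (intro prod.cong) auto

lemma mixture_is_eps_mixture:
  assumes "labelled_gibbs (all_edges N) f M"
    and small: "ln (real (card (Y ` Pow (all_edges N)))) \<le> \<epsilon> * real (N choose 2)"
  shows "is_eps_mixture N \<epsilon> (labelled_gibbs.mixture (all_edges N) M Y)"
proof -
  interpret labelled_gibbs "all_edges N" f M Y by fact
  let ?P = "PiM (all_edges N) (\<lambda>_. borel :: real measure)"
  \<comment> \<open>The mixing measure is the law of the vector of conditional edge probabilities;
    the restriction puts this vector into the space of extensional functions underlying
    \<open>PiM\<close>.\<close>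
  define R where "R y = restrict (marginal y) (all_edges N)" for y
  define \<rho> where "\<rho> = distr (measure_pmf (map_pmf Y M)) ?P R"
  have R_meas: "R \<in> measurable (measure_pmf (map_pmf Y M)) ?P"
    by (auto simp: R_def space_PiM)
  have int_\<rho>: "(\<integral>p. h p \<partial>\<rho>) = (\<Sum>y\<in>labels. pmf (map_pmf Y M) y * h (R y))"
    if "h \<in> borel_measurable ?P" for h :: "(nat set \<Rightarrow> real) \<Rightarrow> real"
  proof -
    have "(\<integral>p. h p \<partial>\<rho>) = measure_pmf.expectation (map_pmf Y M) (\<lambda>y. h (R y))"
      unfolding \<rho>_def by (rule integral_distr[OF R_meas that])
    then show ?thesis
      using set_label by (subst (asm) integral_measure_pmf[OF finite_labels]) (auto simp del: set_map_pmf integral_map_pmf)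
  qed
  have [measurable]: "xlnx \<in> borel_measurable borel"
    unfolding xlnx_def by measurable
  have prob_meas: "(\<lambda>p. indep_graph_prob N p g) \<in> borel_measurable ?P" for g
    unfolding indep_graph_prob_def by (intro borel_measurable_prod) (auto intro!: measurable_component_singleton)
  have ent_meas: "I_ent N \<in> borel_measurable ?P"
    unfolding I_ent_def by measurable
  have "prob_space \<rho>"
    unfolding \<rho>_def by (intro measure_pmf.prob_space_distr R_meas)
  moreover have "sets \<rho> = sets ?P" by (simp add: \<rho>_def)
  moreover have "AE p in \<rho>. \<forall>e\<in>all_edges N. 0 \<le> p e \<and> p e \<le> 1"
    unfolding \<rho>_def
  proof (subst AE_distr_iff[OF R_meas])
    show "{p \<in> space ?P. \<forall>e\<in>all_edges N. 0 \<le> p e \<and> p e \<le> 1} \<in> sets ?P" by measurable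
    show "AE y in measure_pmf (map_pmf Y M). \<forall>e\<in>all_edges N. 0 \<le> R y e \<and> R y e \<le> 1"
      using marginal_bounds by (auto simp: R_def)
  qed
  moreover have "set_pmf mixture \<subseteq> graphs N"
    using set_mixture by (simp add: graphs_def)
  moreover have "pmf mixture g = (\<integral>p. indep_graph_prob N p g \<partial>\<rho>)" if "g \<in> graphs N" for g
  proof -
    have "pmf (indep_set (all_edges N) (marginal y)) g = indep_graph_prob N (R y) g" for y
    proof -
      have "indep_graph_prob N (R y) g = indep_graph_prob N (marginal y) g"
        by (rule indep_graph_prob_cong) (simp add: R_def)
      then show ?thesis
        using that marginal_bounds by (simp add: pmf_indep_set indep_graph_prob_def graphs_def)
    qed
    then show ?thesis unfolding int_\<rho>[OF prob_meas] pmf_mixture by simp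
  qed
  ultimately have "is_mixture_of N \<rho> mixture" unfolding is_mixture_of_def by blast
  moreover have "graph_entropy N mixture \<le> (\<integral>p. I_ent N p \<partial>\<rho>) + \<epsilon> * real (N choose 2)"
  proof -
    have "graph_entropy N mixture = - (\<Sum>G\<in>Pow (all_edges N). pmf mixture G * ln (pmf mixture G))"
      by (simp add: graph_entropy_def graphs_def xlnx_eq)
    also have "\<dots> \<le> (\<Sum>y\<in>labels. pmf (map_pmf Y M) y * I_ent N (marginal y)) + ln (real (card labels))"
      using mixture_entropy_le by (simp add: I_ent_def xlnx_eq)
    also have "(\<Sum>y\<in>labels. pmf (map_pmf Y M) y * I_ent N (marginal y)) = (\<integral>p. I_ent N p \<partial>\<rho>)"
    proof -
      have "I_ent N (R y) = I_ent N (marginal y)" for y by (rule I_ent_cong) (simp add: R_def)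
      then show ?thesis unfolding int_\<rho>[OF ent_meas] by simp
    qed
    finally show ?thesis using small by linarith
  qed
  ultimately show ?thesis unfolding is_eps_mixture_def by blast
qed

lemma set_dist_le_card:
  assumes "finite E" "X \<subseteq> E" "Y \<subseteq> E"
  shows "set_dist X Y \<le> real (card E)"
  unfolding set_dist_def of_nat_le_iff using assms by (intro card_mono) auto

text \<open>Collects the estimates with the number \<open>T\<close> of recorded cuts and Marton's
  \<open>c\<close> still free. \<open>L\<close> is the entropy per cut,
  \<open>2 * n / sqrt (Suc T)\<close> bounds the expected cut distance, and the term with
  \<open>sqrt (real N)\<close> is the collision error.\<close>

lemma ergm_mixture_coupling:
  fixes N l T :: nat and H :: "nat \<Rightarrow> nat \<times> nat set set" and \<beta> :: "nat \<Rightarrow> real"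
  defines "n \<equiv> real (N choose 2)" and "B \<equiv> \<Sum>i<l. \<bar>\<beta> i\<bar> * real (card (snd (H i)))"
    and "L \<equiv> ln (2 ^ (2 * N + 1) :: real)"
  assumes H: "\<forall>i<l. is_simple_graph (H i)"
  obtains \<mu> :: "(nat set set \<times> nat set set) pmf" where
    "is_ergm_law N l H \<beta> (map_pmf fst \<mu>)"
    "\<And>\<epsilon>. real T * L \<le> \<epsilon> * n \<Longrightarrow> is_eps_mixture N \<epsilon> (map_pmf snd \<mu>)"
    "measure_pmf.expectation \<mu> (\<lambda>(g, g'). set_dist g g') \<le> n"
    "\<And>c. 0 < c \<Longrightarrow> 0 < N \<Longrightarrow> measure_pmf.expectation \<mu> (\<lambda>(g, g'). set_dist g g')
      \<le> (c * n + (real T * L + B * (2 * n / sqrt (real (Suc T)) + 2 * (real N * sqrt (real N)))) / c) / 2"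
proof -
  define f where "f g = real N ^ 2 * (\<Sum>i<l. \<beta> i * hom_density (H i) N g)" for g
  let ?E = "all_edges N"
  let ?J = "cut_directions N" and ?x = "\<lambda>(X :: nat set set) u. of_bool (u \<in> X) :: real"
  obtain M where M: "\<And>X. pmf M X = (if X \<subseteq> ?E then exp (f X) / (\<Sum>X\<in>Pow ?E. exp (f X)) else 0)"
    using gibbs_pmf_exists[OF finite_all_edges] by blast
  have set_M_sub: "set_pmf M \<subseteq> Pow ?E" by (auto simp: set_pmf_eq M split: if_splits)
  have sum_M: "(\<Sum>X\<in>Pow ?E. pmf M X) = 1"
    by (rule sum_pmf_eq_1[OF _ set_M_sub]) simp
  have "\<exists>Y :: nat set set \<Rightarrow> (nat set \<times> nat set \<times> real) list. card (Y ` Pow ?E) \<le> card ?J ^ T \<and>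
    (\<Sum>X\<in>Pow ?E. pmf M X * max_corr (pmf M) (Pow ?E) ?E ?x ?J cut_vector Y X) \<le> 2 * real (card ?E) / sqrt (real (Suc T))"
    by (rule low_correlation_labelling)
       (use sum_M finite_cut_directions cut_directions_nonempty cut_vector_bound in auto)
  then obtain Y :: "nat set set \<Rightarrow> (nat set \<times> nat set \<times> real) list" where
    card_Y: "card (Y ` Pow ?E) \<le> card ?J ^ T" and
    corr: "(\<Sum>X\<in>Pow ?E. pmf M X * max_corr (pmf M) (Pow ?E) ?E ?x ?J cut_vector Y X) \<le> 2 * n / sqrt (real (Suc T))"
    by (auto simp: card_all_edges n_def)
  have LG: "labelled_gibbs ?E f M"
    by standard (simp_all add: M)
  interpret labelled_gibbs ?E f M Y by (rule LG)
  obtain \<mu> where \<mu>: "map_pmf fst \<mu> = M" "map_pmf snd \<mu> = mixture"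
    and dist: "\<And>c. 0 < c \<Longrightarrow> measure_pmf.expectation \<mu> (\<lambda>(X, Y). set_dist X Y) \<le> (c * real (card ?E) + mean_field_gap / c) / 2"
    using mixture_coupling by blast
  have ln_card: "ln (real (card labels)) \<le> real T * L"
  proof -
    have "0 < card labels" using finite_labels labels_nonempty by (simp add: card_gt_0_iff)
    then have "ln (real (card labels)) \<le> ln (real (card ?J ^ T))"
      using card_Y by (subst ln_le_cancel_iff) (auto simp: card_gt_0_iff finite_cut_directions cut_directions_nonempty simp flip: of_nat_power)
    also have "\<dots> = real T * L" by (simp only: card_cut_directions L_def of_nat_power of_nat_numeral ln_realpow)
    finally show ?thesis .
  qed
  have law: "is_ergm_law N l H \<beta> M"
    unfolding is_ergm_law_def ergm_weight_def graphs_def f_def[symmetric] by (simp add: M)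
  have eps: "is_eps_mixture N \<epsilon> mixture" if "real T * L \<le> \<epsilon> * n" for \<epsilon>
    using order_trans[OF ln_card that] unfolding n_def by (rule mixture_is_eps_mixture[OF LG])
  have set_\<mu>: "set_pmf \<mu> \<subseteq> Pow ?E \<times> Pow ?E"
  proof -
    have "fst ` set_pmf \<mu> \<subseteq> Pow ?E" "snd ` set_pmf \<mu> \<subseteq> Pow ?E"
      unfolding set_map_pmf[symmetric] \<mu> using set_M_sub set_mixture by auto
    then show ?thesis unfolding image_subset_iff by (intro subsetI) (simp add: mem_Times_iff)
  qed
  have le_n: "measure_pmf.expectation \<mu> (\<lambda>(g, g'). set_dist g g') \<le> n"
  proof (rule measure_pmf.integral_le_const)
    have "finite (set_pmf \<mu>)" using finite_subset[OF set_\<mu>] by simp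
    then show "integrable (measure_pmf \<mu>) (\<lambda>(g, g'). set_dist g g')" by (rule integrable_measure_pmf_finite)
    have "set_dist (fst z) (snd z) \<le> n" if "z \<in> set_pmf \<mu>" for z
      using set_dist_le_card[OF finite_all_edges, of "fst z" N "snd z"] subsetD[OF set_\<mu> that]
      by (auto simp: n_def card_all_edges mem_Times_iff)
    then show "AE z in measure_pmf \<mu>. (case z of (g, g') \<Rightarrow> set_dist g g') \<le> n"
      unfolding AE_measure_pmf_iff by (auto simp: case_prod_unfold)
  qed
  have gap: "mean_field_gap \<le> real T * L + B * (2 * n / sqrt (real (Suc T)) + 2 * (real N * sqrt (real N)))" if N: "0 < N"
  proof -
    let ?D = "max_corr (pmf M) (Pow ?E) ?E ?x ?J cut_vector Y"
    let ?w = "2 * (real N * sqrt (real N))"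
    have B0: "0 \<le> B" unfolding B_def by (intro sum_nonneg) auto
    have pointwise: "f X - (\<Sum>G\<in>Pow ?E. pmf (indep_set ?E (marginal (Y X))) G * f G) \<le> B * (?D X + ?w)"
      if X: "X \<in> Pow ?E" for X
    proof -
      let ?q = "indep_set ?E (marginal (Y X))"
      have "(\<Sum>G\<in>Pow ?E. pmf ?q G * f G) = (\<Sum>i<l. real N ^ 2 * (\<beta> i * (\<Sum>G\<in>Pow ?E. pmf ?q G * hom_density (H i) N G)))"
        unfolding f_def sum_distrib_left by (subst sum.swap) (simp add: mult_ac)
      then have "f X - (\<Sum>G\<in>Pow ?E. pmf ?q G * f G)
         = (\<Sum>i<l. real N ^ 2 * (\<beta> i * (hom_density (H i) N X - (\<Sum>G\<in>Pow ?E. pmf ?q G * hom_density (H i) N G))))"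
        by (simp add: f_def sum_distrib_left right_diff_distrib sum_subtractf)
      also have "\<dots> \<le> (\<Sum>i<l. \<bar>\<beta> i\<bar> * real (card (snd (H i))) * (?D X + ?w))"
      proof (rule sum_mono)
        fix i assume i: "i \<in> {..<l}"
        obtain m F where HF: "H i = (m, F)" by (cases "H i")
        have "snd (H i) \<subseteq> all_edges (fst (H i))" using H i by (simp add: is_simple_graph_def)
        then have F: "F \<subseteq> all_edges m" by (simp add: HF)
        have cut: "\<bar>\<Sum>i\<in>A. \<Sum>j\<in>B. of_bool ({i, j} \<in> X) - (if {i, j} \<in> ?E then marginal (Y X) {i, j} else 0)\<bar> \<le> ?D X"
          if "A \<subseteq> {..<N}" "B \<subseteq> {..<N}" for A B
          unfolding marginal_def by (rule cut_le_max_corr) (use that X in auto)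
        have "real N ^ 2 * (\<beta> i * (hom_density (m, F) N X - (\<Sum>G\<in>graphs N. pmf ?q G * hom_density (m, F) N G)))
            \<le> \<bar>\<beta> i\<bar> * real (card F) * (?D X + 2 * real N * sqrt (real N))"
          by (rule hom_density_mean_field[OF _ F N _ cut]) (use marginal_bounds X in auto)
        then show "real N ^ 2 * (\<beta> i * (hom_density (H i) N X - (\<Sum>G\<in>Pow ?E. pmf ?q G * hom_density (H i) N G)))
            \<le> \<bar>\<beta> i\<bar> * real (card (snd (H i))) * (?D X + ?w)"
          by (simp add: HF graphs_def mult.assoc)
      qed
      also have "\<dots> = B * (?D X + ?w)" by (simp add: B_def sum_distrib_right)
      finally show ?thesis .
    qed
    have "(\<Sum>X\<in>Pow ?E. pmf M X * (f X - (\<Sum>G\<in>Pow ?E. pmf (indep_set ?E (marginal (Y X))) G * f G)))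
        \<le> (\<Sum>X\<in>Pow ?E. pmf M X * (B * (?D X + ?w)))"
      using pointwise by (intro sum_mono mult_left_mono) auto
    also have "\<dots> = (\<Sum>X\<in>Pow ?E. B * (pmf M X * ?D X) + pmf M X * (B * ?w))"
      by (intro sum.cong refl) (simp add: algebra_simps)
    also have "\<dots> = B * (\<Sum>X\<in>Pow ?E. pmf M X * ?D X) + B * ?w"
      unfolding sum.distrib sum_distrib_left[symmetric] sum_distrib_right[symmetric] sum_M by simp
    also have "\<dots> \<le> B * (2 * n / sqrt (real (Suc T))) + B * ?w"
      using corr B0 by (intro add_right_mono mult_left_mono)
    finally show ?thesis unfolding mean_field_gap_def using ln_card by (simp add: distrib_left)
  qed
  show ?thesis
  proof (rule that[of \<mu>])
    show "is_ergm_law N l H \<beta> (map_pmf fst \<mu>)" unfolding \<mu> by (rule law)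
    show "is_eps_mixture N \<epsilon> (map_pmf snd \<mu>)" if "real T * L \<le> \<epsilon> * n" for \<epsilon>
      unfolding \<mu> using that by (rule eps)
    show "measure_pmf.expectation \<mu> (\<lambda>(g, g'). set_dist g g') \<le> n" by (rule le_n)
    fix c :: real assume c: "0 < c" and N: "0 < N"
    have "mean_field_gap / c \<le> (real T * L + B * (2 * n / sqrt (real (Suc T)) + 2 * (real N * sqrt (real N)))) / c"
      using gap[OF N] c by (intro divide_right_mono) auto
    then show "measure_pmf.expectation \<mu> (\<lambda>(g, g'). set_dist g g')
      \<le> (c * n + (real T * L + B * (2 * n / sqrt (real (Suc T)) + 2 * (real N * sqrt (real N)))) / c) / 2"
      using dist[OF c] by (simp add: n_def card_all_edges)
  qed
qed

text \<open>The parameters stand for \<open>a = n\<^bsup>1/12\<^esup>\<close>, \<open>e = \<epsilon>\<^bsup>1/6\<^esup>\<close>, \<open>b = B\<^bsup>1/3\<^esup>\<close>, where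
  \<open>n\<close> is the number of possible edges and \<open>B\<close> the total interaction strength; \<open>h\<^sup>2 n\<close> is
  the entropy spent on labels, which balances the two error terms unless it exceeds \<open>\<epsilon> n\<close>.\<close>
lemma parameter_choice:
  fixes a b e h L W :: real and T :: nat
  assumes a: "1 \<le> a" and b: "0 \<le> b" and e: "0 < e" "e < 1"
    and L: "0 < L" "L \<le> 5 * a ^ 6" and W: "0 \<le> W" "W \<le> 3 * a ^ 9"
    and h: "h = min (e ^ 3) (b / a)" and T: "T = nat \<lfloor>h\<^sup>2 * a ^ 12 / L\<rfloor>" and small: "b / (a * e\<^sup>2) < 1"
  shows "real T * L + b ^ 3 * (2 * a ^ 12 / sqrt (real (Suc T)) + 2 * W) \<le> 12 * a ^ 12 * (b / (a * e\<^sup>2))\<^sup>2"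
proof (cases "b = 0")
  case True
  then show ?thesis using e by (simp add: h T)
next
  case False
  define x where "x = b / a"
  have x: "0 < x" using False a b by (simp add: x_def)
  have b_eq: "b = x * a" using a by (simp add: x_def)
  have h_min: "h = min (e ^ 3) x" by (simp add: h x_def)
  have h_pos: "0 < h" using x e by (simp add: h_min)
  have h1: "h \<le> 1" using e by (simp add: h_min min_le_iff_disj power_le_one)
  define r where "r = h\<^sup>2 * a ^ 12 / L"
  have r0: "0 \<le> r" using L by (simp add: r_def)
  have TL: "real T * L \<le> h\<^sup>2 * a ^ 12"
  proof -
    have "real T \<le> r" using r0 by (simp add: T r_def[symmetric])
    then have "real T * L \<le> r * L" using L by (intro mult_right_mono) auto
    then show ?thesis using L by (simp add: r_def)
  qed
  \<comment> \<open>\<open>Suc T\<close> exceeds \<open>r\<close> despite the floor, and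
    \<open>L \<le> 5 * a ^ 6\<close> gives \<open>r \<ge> h^2 * a^6 / 5\<close>. The factor
    \<open>5 / 2\<close> suffices because \<open>4 / 25 \<le> 1 / 5\<close>.\<close>
  have sq: "h * a ^ 3 / (5 / 2) \<le> sqrt (real (Suc T))"
  proof (rule real_le_rsqrt)
    have "(h * a ^ 3 / (5 / 2))\<^sup>2 = h\<^sup>2 * a ^ 6 * (4 / 25)" by (simp add: power2_eq_square power_numeral_reduce)
    also have "\<dots> \<le> h\<^sup>2 * a ^ 6 * (1 / 5)" using a by (intro mult_left_mono) auto
    also have "\<dots> = h\<^sup>2 * a ^ 12 / (5 * a ^ 6)"
      using a by (simp add: field_simps)
    also have "\<dots> \<le> r" unfolding r_def using L a by (intro divide_left_mono) auto
    also have "\<dots> \<le> real (Suc T)" unfolding T r_def[symmetric] using r0 by linarith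
    finally show "(h * a ^ 3 / (5 / 2))\<^sup>2 \<le> real (Suc T)" .
  qed
  have dev: "2 * a ^ 12 / sqrt (real (Suc T)) \<le> 5 * a ^ 9 / h"
  proof -
    have "2 * a ^ 12 / sqrt (real (Suc T)) \<le> 2 * a ^ 12 / (h * a ^ 3 / (5 / 2))"
      using sq h_pos a by (intro divide_left_mono mult_pos_pos) auto
    also have "\<dots> = 5 * a ^ 9 / h"
      using a h_pos by (simp add: field_simps)
    finally show ?thesis .
  qed
  have W': "2 * W \<le> 6 * a ^ 9 / h"
  proof -
    have "2 * W \<le> 6 * a ^ 9" using W by simp
    also have "\<dots> \<le> 6 * a ^ 9 / h" using h_pos h1 a by (simp add: le_divide_eq mult_left_le)
    finally show ?thesis .
  qed
  have "real T * L + b ^ 3 * (2 * a ^ 12 / sqrt (real (Suc T)) + 2 * W)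
      \<le> h\<^sup>2 * a ^ 12 + b ^ 3 * (5 * a ^ 9 / h + 6 * a ^ 9 / h)"
    using TL dev W' b by (intro add_mono mult_left_mono) auto
  \<comment> \<open>With \<open>b = x * a\<close>, the factor \<open>b ^ 3\<close> raises
    \<open>a ^ 9\<close> to \<open>a ^ 12\<close>, so all terms scale alike.\<close>
  also have "\<dots> = a ^ 12 * (h\<^sup>2 + 11 * (x ^ 3 / h))"
    using h_pos by (simp add: b_eq power_mult_distrib field_simps)
  also have "\<dots> \<le> a ^ 12 * (12 * (x / e\<^sup>2)\<^sup>2)"
  proof (intro mult_left_mono)
    have e2: "0 < e\<^sup>2" "e\<^sup>2 \<le> 1" using e by (auto simp: power_le_one)
    have x2: "x\<^sup>2 \<le> (x / e\<^sup>2)\<^sup>2"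
    proof -
      have "x \<le> x / e\<^sup>2" using e2 x by (simp add: le_divide_eq mult_left_le)
      then show ?thesis using x by (intro power_mono) auto
    qed
    have xe: "x / e\<^sup>2 < 1" using small by (simp add: x_def)
    show "h\<^sup>2 + 11 * (x ^ 3 / h) \<le> 12 * (x / e\<^sup>2)\<^sup>2"
    proof (cases "x \<le> e ^ 3")
      case True
      then have "h = x" by (simp add: h_min)
      moreover have "x ^ 3 / x = x\<^sup>2" using x by (simp add: power3_eq_cube power2_eq_square)
      ultimately show ?thesis using x2 by simp
    next
      case False
      then have h3: "h = e ^ 3" by (simp add: h_min)
      have "h\<^sup>2 \<le> x\<^sup>2" using False h_pos unfolding h3 by (intro power_mono) auto
      \<comment> \<open>Here the cap on the budget is active. The excess over the target is the
        factor \<open>x * e\<close>, which is at most 1 because \<open>small\<close> means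
        \<open>x < e^2\<close>.\<close>
      moreover have "x ^ 3 / h \<le> (x / e\<^sup>2)\<^sup>2"
      proof -
        have "x * e \<le> 1"
        proof -
          have "x < e\<^sup>2" using xe e2 by simp
          then have "x * e \<le> e\<^sup>2 * e" using e by (intro mult_right_mono) auto
          also have "\<dots> \<le> 1" using e by (simp add: mult_le_one power_le_one)
          finally show ?thesis .
        qed
        moreover have "x ^ 3 / h = (x / e\<^sup>2)\<^sup>2 * (x * e)"
          using e unfolding h3 by (simp add: field_simps power2_eq_square power3_eq_cube)
        ultimately show ?thesis by (simp add: mult_left_le)
      qed
      ultimately show ?thesis using x2 by linarith
    qed
  qed (use a in auto)
  also have "\<dots> = 12 * a ^ 12 * (b / (a * e\<^sup>2))\<^sup>2" using a by (simp add: x_def)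
  finally show ?thesis .
qed

lemma powr_inverse_nat_power:
  fixes x :: real
  assumes "0 \<le> x" "0 < k"
  shows "(x powr (1 / real k)) ^ k = x"
proof (cases "x = 0")
  case False
  then have "(x powr (1 / real k)) ^ k = x powr (1 / real k * real k)"
    using assms by (simp add: powr_powr flip: powr_realpow)
  then show ?thesis using assms False by simp
qed (use assms in simp)

theorem theorem1p13:
  fixes N l :: nat and H :: "nat \<Rightarrow> nat \<times> nat set set" and \<beta> :: "nat \<Rightarrow> real"
    and \<epsilon> :: real
  assumes "\<forall>i<l. is_simple_graph (H i)"
    and "0 < \<epsilon>" and "\<epsilon> < 1/2"
  shows "\<exists>\<mu> :: (nat set set \<times> nat set set) pmf.
           is_ergm_law N l H \<beta> (map_pmf fst \<mu>) \<and>
           is_eps_mixture N \<epsilon> (map_pmf snd \<mu>) \<and>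
           measure_pmf.expectation \<mu> (\<lambda>(g, g'). real (ham_dist g g'))
             \<le> 20 * real (N choose 2) powr (11/12) / \<epsilon> powr (1/3)
                * (\<Sum>i<l. \<bar>\<beta> i\<bar> * real (card (snd (H i)))) powr (1/3)"
proof -
  define n where "n = real (N choose 2)"
  define B where "B = (\<Sum>i<l. \<bar>\<beta> i\<bar> * real (card (snd (H i))))"
  define L :: real where "L = ln (2 ^ (2 * N + 1))"
  define a b e where "a = n powr (1/12)" and "b = B powr (1/3)" and "e = \<epsilon> powr (1/6)"
  define h where "h = min (e ^ 3) (b / a)"
  \<comment> \<open>For fewer than two vertices \<open>n = 0\<close> leaves no entropy budget, so
    nothing is recorded.\<close>
  define T where "T = (if N < 2 then 0 else nat \<lfloor>h\<^sup>2 * a ^ 12 / L\<rfloor>)"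
  have B0: "0 \<le> B" unfolding B_def by (intro sum_nonneg) auto
  have a12: "a ^ 12 = n" using powr_inverse_nat_power[of n 12] by (simp add: a_def n_def)
  have b3: "b ^ 3 = B" using powr_inverse_nat_power[of B 3] B0 by (simp add: b_def)
  have e6: "e ^ 6 = \<epsilon>" using powr_inverse_nat_power[of \<epsilon> 6] assms(2) by (simp add: e_def)
  have e01: "0 < e" "e < 1"
    using assms(2,3) powr_less_mono2[of "1/6" \<epsilon> 1] by (auto simp: e_def)
  have b0: "0 \<le> b" by (simp add: b_def)
  have a0: "0 \<le> a" by (simp add: a_def)
  have L_eq: "L = (2 * real N + 1) * ln 2" unfolding L_def by (simp only: ln_realpow) simp
  have L0: "0 < L" unfolding L_eq by (simp add: add_nonneg_pos)
  have TL: "real T * L \<le> \<epsilon> * n"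
  proof (cases "N < 2")
    case True
    then show ?thesis using assms(2) by (simp add: T_def n_def)
  next
    case False
    have "real T \<le> h\<^sup>2 * a ^ 12 / L" using False L0 a0 by (simp add: T_def)
    then have "real T * L \<le> h\<^sup>2 * n" using L0 by (simp add: a12 le_divide_eq)
    moreover have "h\<^sup>2 \<le> (e ^ 3)\<^sup>2"
      using e01 b0 a0 by (intro power_mono) (auto simp: h_def)
    moreover have "(e ^ 3)\<^sup>2 = \<epsilon>" using e6 by (simp flip: power_mult)
    ultimately show ?thesis by (smt (verit) n_def mult_right_mono of_nat_0_le_iff)
  qed
  obtain \<mu> where law: "is_ergm_law N l H \<beta> (map_pmf fst \<mu>)"
    and mix: "is_eps_mixture N \<epsilon> (map_pmf snd \<mu>)"
    and le_n: "measure_pmf.expectation \<mu> (\<lambda>(g, g'). set_dist g g') \<le> n"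
    and dist: "\<And>c. 0 < c \<Longrightarrow> 0 < N \<Longrightarrow> measure_pmf.expectation \<mu> (\<lambda>(g, g'). set_dist g g')
      \<le> (c * n + (real T * L + B * (2 * n / sqrt (real (Suc T)) + 2 * (real N * sqrt (real N)))) / c) / 2"
  proof (rule ergm_mixture_coupling[OF assms(1), where T = T and N = N and \<beta> = \<beta>, folded n_def B_def L_def])
    fix \<mu> :: "(nat set set \<times> nat set set) pmf"
    assume 1: "is_ergm_law N l H \<beta> (map_pmf fst \<mu>)"
      and 2: "\<And>\<epsilon>. real T * L \<le> \<epsilon> * n \<Longrightarrow> is_eps_mixture N \<epsilon> (map_pmf snd \<mu>)"
      and 3: "measure_pmf.expectation \<mu> (\<lambda>(g, g'). set_dist g g') \<le> n"
      and 4: "\<And>c. 0 < c \<Longrightarrow> 0 < N \<Longrightarrow> measure_pmf.expectation \<mu> (\<lambda>(g, g'). set_dist g g')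
      \<le> (c * n + (real T * L + B * (2 * n / sqrt (real (Suc T)) + 2 * (real N * sqrt (real N)))) / c) / 2"
    show thesis by (rule that[OF 1 2[OF TL] 3 4])
  qed
  let ?d = "measure_pmf.expectation \<mu> (\<lambda>(g, g'). set_dist g g')"
  \<comment> \<open>\<open>20 * n * z\<close> is the claimed bound; for \<open>z \<ge> 1\<close> it
    exceeds the trivial bound \<open>n\<close>.\<close>
  define z where "z = b / (a * e\<^sup>2)"
  have z0: "0 \<le> z" using b0 a0 by (simp add: z_def)
  have "?d \<le> 20 * n * z"
  proof (cases "N < 2 \<or> 1 \<le> z")
    case True
    then show ?thesis
    proof
      assume "N < 2"
      then have "n = 0" by (simp add: n_def)
      then show ?thesis using le_n by simp
    next
      assume "1 \<le> z"
      then have "n * 1 \<le> n * (20 * z)" by (intro mult_left_mono) (auto simp: n_def)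
      then show ?thesis using le_n by (simp add: mult_ac)
    qed
  next
    case False
    then have N: "2 \<le> N" and z1: "z < 1" by auto
    have N_sq: "real N * real N \<le> 4 * n"
    proof -
      have "even (N * (N - 1))" by (cases N) auto
      then have "2 * (N choose 2) = N * (N - 1)" unfolding choose_two by (rule dvd_mult_div_cancel)
      then have "real (2 * (N choose 2)) = real (N * (N - 1))" by (simp only:)
      then have "2 * n = real N * (real N - 1)" using N by (simp add: n_def of_nat_diff)
      moreover have "real N * (real N - 1) * 2 \<ge> real N * real N" using N by (simp add: algebra_simps)
      ultimately show ?thesis by linarith
    qed
    have n1: "1 \<le> n"
      using N by (simp add: n_def Suc_le_eq)
    have a1: "1 \<le> a" unfolding a_def using n1 by (intro ge_one_powr_ge_zero) auto
    have N_le: "real N \<le> 2 * a ^ 6"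
    proof (rule power2_le_imp_le)
      have "(2 * a ^ 6)\<^sup>2 = 4 * n" by (simp add: power_mult_distrib a12[symmetric] flip: power_mult)
      then show "(real N)\<^sup>2 \<le> (2 * a ^ 6)\<^sup>2" using N_sq by (simp add: power2_eq_square)
    qed (use a0 in simp)
    have L5: "L \<le> 5 * a ^ 6"
    proof -
      have "L \<le> (2 * real N + 1) * 1" unfolding L_eq using ln_2_less_1 by (intro mult_left_mono) auto
      also have "\<dots> \<le> (5 / 2) * real N" using N by simp
      also have "\<dots> \<le> 5 * a ^ 6" using N_le by simp
      finally show ?thesis .
    qed
    have W: "real N * sqrt (real N) \<le> 3 * a ^ 9"
    proof (rule power2_le_imp_le)
      have "(real N * sqrt (real N))\<^sup>2 = real N ^ 3" by (simp add: power_mult_distrib power2_eq_square power3_eq_cube)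
      also have "\<dots> \<le> (2 * a ^ 6) ^ 3" using N_le by (intro power_mono) auto
      also have "\<dots> = 8 * a ^ 18" by (simp add: power_mult_distrib flip: power_mult)
      also have "\<dots> \<le> 9 * a ^ 18" using a0 by simp
      also have "\<dots> = (3 * a ^ 9)\<^sup>2" by (simp add: power_mult_distrib flip: power_mult)
      finally show "(real N * sqrt (real N))\<^sup>2 \<le> (3 * a ^ 9)\<^sup>2" .
    qed (use a0 in simp)
    have K: "real T * L + B * (2 * n / sqrt (real (Suc T)) + 2 * (real N * sqrt (real N))) \<le> 12 * n * z\<^sup>2"
      unfolding a12[symmetric] b3[symmetric] z_def
      by (rule parameter_choice[where h = h]) (use a1 b0 e01 L0 L5 W z1 N in \<open>auto simp: h_def T_def z_def\<close>)
    have d_le: "?d \<le> (c * n + 12 * n * z\<^sup>2 / c) / 2" if "0 < c" for c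
    proof -
      have "(real T * L + B * (2 * n / sqrt (real (Suc T)) + 2 * (real N * sqrt (real N)))) / c \<le> 12 * n * z\<^sup>2 / c"
        using K that by (intro divide_right_mono) auto
      then show ?thesis using dist[OF that] N by simp
    qed
    \<comment> \<open>The choice \<open>c = z\<close> gives the constant
      \<open>(1 + 12) / 2\<close>. If \<open>z = 0\<close>, there is no interaction, and
      \<open>c\<close> tends to 0 instead.\<close>
    show ?thesis
    proof (cases "z = 0")
      case True
      have "?d \<le> 0 + \<delta>" if "0 < \<delta>" for \<delta>
        using d_le[of "2 * \<delta> / n"] that n1 True by simp
      then have "?d \<le> 0" by (rule field_le_epsilon)
      then show ?thesis using True by simp
    next
      case False
      then have "?d \<le> (z * n + 12 * n * z\<^sup>2 / z) / 2" using d_le[of z] z0 by simp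
      also have "\<dots> = 13 / 2 * (n * z)" using False by (simp add: power2_eq_square)
      also have "\<dots> \<le> 20 * (n * z)" using n1 z0 by (intro mult_right_mono) auto
      finally show ?thesis by simp
    qed
  qed
  also have "20 * n * z = 20 * n powr (11/12) / \<epsilon> powr (1/3) * B powr (1/3)"
  proof -
    have "20 * n * z = 20 * (n * inverse a) / e\<^sup>2 * b"
      by (simp add: z_def divide_inverse mult_ac)
    also have "n * inverse a = n powr (11/12)"
    proof (cases "n = 0")
      case False
      then have "n * inverse a = n powr 1 * n powr - (1/12)"
        by (simp add: a_def powr_minus n_def)
      also have "\<dots> = n powr (1 + - (1/12))" by (rule powr_add[symmetric])
      finally show ?thesis by simp
    qed simp
    also have "e\<^sup>2 = \<epsilon> powr (1/3)"
      unfolding e_def power2_eq_square powr_add[symmetric] by simp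
    finally show ?thesis unfolding b_def .
  qed
  finally have "?d \<le> 20 * n powr (11/12) / \<epsilon> powr (1/3) * B powr (1/3)" .
  then show ?thesis
    using law mix unfolding n_def B_def set_dist_def ham_dist_def by blast
qed

end
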